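(* Let $G$ be a Lie group with Lie algebra $\mathfrak g$, let $a^1,\dots,a^m\in\mathfrak g^*$ be linearly independent and $\mathfrak g^{D}=\{\xi\in\mathfrak g : \langle a^\alpha,\xi\rangle=0,\ \alpha=1,\dots,m\}$. Let $\epsilon>0$, $N\ge 2$, let $\tau:\mathfrak g\to G$ be a retraction map, let $\tilde l_d:\mathfrak g\to\mathbb R$ be a smooth function (Lagrangian), let $\varphi_d^\alpha:G\to\mathbb R$, $\alpha=1,\dots,m$, be the functions defining the discrete displacement subvariety $\mathcal S\subset G$, and put $\tilde\varphi_d^\alpha:=\varphi_d^\alpha\circ\tau:\mathfrak g\to\mathbb R$. Let $\{\xi_k\}_{k=0}^{N-1}\subset\mathfrak g$ be a sequence (with all $\pm\epsilon\xi_k$ in the domain on which $\tau$ is a diffeomorphism) such that $\tilde\varphi_d^\alpha(\xi_0)=0$ for all $\alpha$. Then the following are equivalent: 1. $\tilde\varphi^\alpha_d(\xi_k)=0$ for all $\alpha$ and all $k=0,\dots,N-1$, and $\{\xi_k\}_{k=0}^{N-1}$ is a critical point of the action sum $\tilde s_d=\sum_{k=0}^{N-1}\tilde l_d(\xi_k)$ with respect to all variations of the form $$\delta\xi_k=\tfrac1\epsilon\,\mathrm d\tau^{-1}_{\epsilon\xi_k}\bigl(-\eta_k+\mathrm{Ad}_{\tau(\epsilon\xi_k)}\eta_{k+1}\bigr),\qquad k=0,\dots,N-1,$$ where $\{\eta_k\}_{k=0}^{N}\subset\mathfrak g^{D}$ is any sequence with $\eta_0=\eta_N=0$. 2. $\{\xi_k\}_{k=0}^{N-1}$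 satisfies the discrete Euler-Poincaré-Suslov equations on the Lie algebra: for each $k=0,\dots,N-2$ there are multipliers $\lambda_\alpha=(\lambda_{k+1})_\alpha\in\mathbb R$ with $$(\mathrm d\tau^{-1}_{\epsilon\xi_{k+1}})^{*}\,\tilde l_d'(\xi_{k+1})-(\mathrm d\tau^{-1}_{-\epsilon\xi_k})^{*}\,\tilde l_d'(\xi_k)=\sum_{\alpha=1}^m\lambda_\alpha a^\alpha,\qquad \tilde\varphi^\alpha_d(\xi_{k+1})=0\ \ (\alpha=1,\dots,m).$$
   Context: A retraction map $\tau:\mathfrak g\to G$ is a map which is an analytic diffeomorphism from a neighborhood of $0\in\mathfrak g$ onto a neighborhood of the identity $e\in G$ and satisfies $\tau(\xi)\tau(-\xi)=e$. Its trivialized tangent $\mathrm d\tau_\xi:\mathfrak g\to\mathfrak g$ is the linear map defined by $\partial_\xi\tau(\xi)\,\eta=(\mathrm d\tau_\xi\,\eta)\,\tau(\xi)$ for $\eta\in\mathfrak g$ (the product on the right is the tangent of right translation by $\tau(\xi)$), and $\mathrm d\tau_\xi^{-1}$ is its inverse; $(\mathrm d\tau^{-1}_\xi)^*:\mathfrak g^*\to\mathfrak g^*$ is the transpose of $\mathrm d\tau_\xi^{-1}$. $\tilde l_d'(\xi)\in\mathfrak g^*$ is the derivative of $\tilde l_d$ at $\xi$. The discrete displacement subvariety $\mathcal S\subset G$ is the submanifold (containing $e$, of codimension $m$) such that a left-invariant discrete constraint submanifold $D_d\subset G\times G$ is given by $(g_k,g_{k+1})\in D_d\iff g_k^{-1}g_{k+1}\in\mathcal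 S$; it is given as the common zero set of smooth functions $\varphi^\alpha_d:G\to\mathbb R$. The sequences $\xi_k$ correspond to sequences $g_k\in G$ by $g_{k+1}=g_k\tau(\epsilon\xi_k)$, and $\eta_k=g_k^{-1}\delta g_k$. "Critical point" in item 1 means $\sum_{k=0}^{N-1}\langle \tilde l_d'(\xi_k),\delta\xi_k\rangle=0$ for all variations of the stated form. *)

theory Defs
  imports "HOL-Analysis.Analysis"
begin

section \<open>Smooth and real-analytic maps between Euclidean spaces\<close>

text \<open>For open \<open>S\<close> and finite-dimensional domain this is the usual notion of class \<open>C\<^sup>n\<close>:
  all iterated directional derivatives up to order \<open>n\<close> exist and are continuous.\<close>

primrec Cn_on :: "nat \<Rightarrow> 'a::real_normed_vector set \<Rightarrow> ('a \<Rightarrow> 'b::real_normed_vector) \<Rightarrow> bool" where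
  "Cn_on 0 S f \<longleftrightarrow> continuous_on S f"
| "Cn_on (Suc n) S f \<longleftrightarrow>
     (\<exists>f'. (\<forall>x\<in>S. (f has_derivative f' x) (at x)) \<and> (\<forall>v. Cn_on n S (\<lambda>x. f' x v)))"

definition smooth_on :: "'a::real_normed_vector set \<Rightarrow> ('a \<Rightarrow> 'b::real_normed_vector) \<Rightarrow> bool" where
  "smooth_on S f \<longleftrightarrow> (\<forall>n. Cn_on n S f)"

text \<open>Around every point of \<open>S\<close>, \<open>f\<close> is the sum of a power series; multi-indices are functions on
  the basis, set to \<open>0\<close> outside \<open>Basis\<close> so that each monomial occurs once.  Smoothness is implied by
  the power series expansion (for open \<open>S\<close>); it is listed as in the usual textbook definition
  of a real-analytic function.\<close>

definition real_analytic_on :: "'a::euclidean_space set \<Rightarrow> ('a \<Rightarrow> 'b::euclidean_space) \<Rightarrow> bool" where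
  "real_analytic_on S f \<longleftrightarrow> smooth_on S f \<and>
     (\<forall>x\<in>S. \<exists>(c :: ('a \<Rightarrow> nat) \<Rightarrow> 'b) r. 0 < r \<and>
        (\<forall>h. norm h < r \<longrightarrow>
           ((\<lambda>\<alpha>. (\<Prod>b\<in>Basis. (h \<bullet> b) ^ \<alpha> b) *\<^sub>R c \<alpha>) has_sum f (x + h))
             {\<alpha>. \<forall>b. b \<notin> Basis \<longrightarrow> \<alpha> b = 0}))"


section \<open>Manifolds\<close>

text \<open>A chart is a pair of its domain and its coordinate map (whose values outside the domain
  are irrelevant).\<close>

type_synonym ('p, 'm) chart = "'p set \<times> ('p \<Rightarrow> 'm)"

definition is_chart :: "('p::topological_space, 'm::euclidean_space) chart \<Rightarrow> bool" where
  "is_chart = (\<lambda>(U, \<phi>). open U \<and> open (\<phi> ` U) \<and> homeomorphism U (\<phi> ` U) \<phi> (inv_into U \<phi>))"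

definition analytic_atlas :: "('p::topological_space, 'm::euclidean_space) chart set \<Rightarrow> bool" where
  "analytic_atlas A \<longleftrightarrow>
     (\<forall>c\<in>A. is_chart c) \<and> (\<Union>(U, \<phi>)\<in>A. U) = UNIV \<and>
     (\<forall>(U, \<phi>)\<in>A. \<forall>(V, \<psi>)\<in>A. real_analytic_on (\<phi> ` (U \<inter> V)) (\<psi> \<circ> inv_into U \<phi>))"

text \<open>The map \<open>f\<close>, defined on the open set \<open>S\<close>, has the regularity \<open>P\<close> when read in the charts
  of \<open>A\<close> and \<open>B\<close>.\<close>

definition regular_map ::
  "('m set \<Rightarrow> ('m \<Rightarrow> 'n) \<Rightarrow> bool) \<Rightarrow> ('p::topological_space, 'm::euclidean_space) chart set \<Rightarrow>
   ('q::topological_space, 'n::euclidean_space) chart set \<Rightarrow> 'p set \<Rightarrow> ('p \<Rightarrow> 'q) \<Rightarrow> bool" where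
  "regular_map P A B S f \<longleftrightarrow> open S \<and> continuous_on S f \<and>
     (\<forall>(U, \<phi>)\<in>A. \<forall>(V, \<psi>)\<in>B. P (\<phi> ` (S \<inter> U \<inter> f -` V)) (\<psi> \<circ> f \<circ> inv_into U \<phi>))"

abbreviation "smooth_map \<equiv> regular_map smooth_on"
abbreviation "analytic_map \<equiv> regular_map real_analytic_on"

definition prod_atlas ::
  "('p, 'm) chart set \<Rightarrow> ('q, 'n) chart set \<Rightarrow> ('p \<times> 'q, 'm \<times> 'n) chart set" where
  "prod_atlas A B = {(U \<times> V, map_prod \<phi> \<psi>) | U \<phi> V \<psi>. (U, \<phi>) \<in> A \<and> (V, \<psi>) \<in> B}"

definition flat_atlas :: "('m, 'm) chart set" where
  "flat_atlas = {(UNIV, id)}"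

definition analytic_diffeo ::
  "('p::topological_space, 'm::euclidean_space) chart set \<Rightarrow>
   ('q::topological_space, 'n::euclidean_space) chart set \<Rightarrow>
   'p set \<Rightarrow> 'q set \<Rightarrow> ('p \<Rightarrow> 'q) \<Rightarrow> bool" where
  "analytic_diffeo A B S T f \<longleftrightarrow>
     bij_betw f S T \<and> analytic_map A B S f \<and> analytic_map B A T (inv_into S f)"

definition smooth_functions ::
  "('p::topological_space, 'm::euclidean_space) chart set \<Rightarrow> ('p \<Rightarrow> real) set" where
  "smooth_functions A = {f. smooth_map A flat_atlas UNIV f}"

text \<open>Tangent vectors are derivations of the algebra of smooth functions, extended by \<open>0\<close> to
  non-smooth arguments so that equality of tangent vectors is equality of functions.\<close>

definition tangent_space ::
  "('p::topological_space, 'm::euclidean_space) chart set \<Rightarrow> 'p \<Rightarrow> (('p \<Rightarrow> real) \<Rightarrow> real) set" where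
  "tangent_space A p =
     {X. (\<forall>f. f \<notin> smooth_functions A \<longrightarrow> X f = 0) \<and>
         (\<forall>f\<in>smooth_functions A. \<forall>g\<in>smooth_functions A. \<forall>c.
            X (\<lambda>x. f x + g x) = X f + X g \<and>
            X (\<lambda>x. c * f x) = c * X f \<and>
            X (\<lambda>x. f x * g x) = f p * X g + X f * g p)}"

definition pushforward ::
  "('p::topological_space, 'm::euclidean_space) chart set \<Rightarrow> ('p \<Rightarrow> 'p) \<Rightarrow>
   (('p \<Rightarrow> real) \<Rightarrow> real) \<Rightarrow> (('p \<Rightarrow> real) \<Rightarrow> real)" where
  "pushforward A F X = (\<lambda>f. if f \<in> smooth_functions A then X (f \<circ> F) else 0)"

text \<open>The tangent vector \<open>\<partial>\<^sub>\<xi> \<tau>(\<xi>) \<eta>\<close> at \<open>\<tau> \<xi>\<close> of a map \<open>\<tau>\<close> defined on a vector space.\<close>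

definition tangent_of_map ::
  "('p::topological_space, 'm::euclidean_space) chart set \<Rightarrow> ('a::euclidean_space \<Rightarrow> 'p) \<Rightarrow>
   'a \<Rightarrow> 'a \<Rightarrow> (('p \<Rightarrow> real) \<Rightarrow> real)" where
  "tangent_of_map A \<tau> \<xi> \<eta> =
     (\<lambda>f. if f \<in> smooth_functions A then frechet_derivative (f \<circ> \<tau>) (at \<xi>) \<eta> else 0)"

text \<open>\<open>S\<close> is an embedded submanifold of codimension \<open>m\<close>: around each of its points there is a chart
  of the smooth structure in which \<open>S\<close> becomes a linear subspace of codimension \<open>m\<close>.\<close>

definition submanifold ::
  "('p::topological_space, 'm::euclidean_space) chart set \<Rightarrow> nat \<Rightarrow> 'p set \<Rightarrow> bool" where
  "submanifold A m S \<longleftrightarrow>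
     (\<forall>p\<in>S. \<exists>U (\<psi> :: 'p \<Rightarrow> 'm) L. p \<in> U \<and> is_chart (U, \<psi>) \<and>
        (\<forall>(V, \<phi>)\<in>A. smooth_on (\<phi> ` (U \<inter> V)) (\<psi> \<circ> inv_into V \<phi>) \<and>
                     smooth_on (\<psi> ` (U \<inter> V)) (\<phi> \<circ> inv_into U \<psi>)) \<and>
        subspace L \<and> dim L + m = DIM('m) \<and> \<psi> ` (U \<inter> S) = \<psi> ` U \<inter> L)"


section \<open>Lie groups\<close>

text \<open>Every smooth Lie group has exactly one compatible real-analytic structure, and analyticity of
  a retraction map refers to it; Lie groups are therefore given by an analytic atlas.\<close>

definition lie_group ::
  "('g::{t2_space,second_countable_topology}, 'm::euclidean_space) chart set \<Rightarrow>
   ('g \<Rightarrow> 'g \<Rightarrow> 'g) \<Rightarrow> 'g \<Rightarrow> ('g \<Rightarrow> 'g) \<Rightarrow> bool" where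
  "lie_group A mul e invs \<longleftrightarrow>
     group mul e invs \<and> analytic_atlas A \<and>
     analytic_map (prod_atlas A A) A UNIV (\<lambda>(g, h). mul g h) \<and>
     analytic_map A A UNIV invs"

text \<open>The Lie algebra is a vector space \<open>'a\<close> identified with the tangent space at \<open>e\<close> by an
  arbitrary linear isomorphism \<open>\<iota>\<close>; its bracket is not needed.\<close>

definition lie_algebra_iso ::
  "('g::topological_space, 'm::euclidean_space) chart set \<Rightarrow> 'g \<Rightarrow>
   ('a::euclidean_space \<Rightarrow> (('g \<Rightarrow> real) \<Rightarrow> real)) \<Rightarrow> bool" where
  "lie_algebra_iso A e \<iota> \<longleftrightarrow>
     bij_betw \<iota> UNIV (tangent_space A e) \<and>
     (\<forall>\<xi> \<eta> f. \<iota> (\<xi> + \<eta>) f = \<iota> \<xi> f + \<iota> \<eta> f) \<and>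
     (\<forall>c \<xi> f. \<iota> (c *\<^sub>R \<xi>) f = c * \<iota> \<xi> f)"

definition Ad ::
  "('g::topological_space, 'm::euclidean_space) chart set \<Rightarrow> ('g \<Rightarrow> 'g \<Rightarrow> 'g) \<Rightarrow> ('g \<Rightarrow> 'g) \<Rightarrow>
   ('a::euclidean_space \<Rightarrow> (('g \<Rightarrow> real) \<Rightarrow> real)) \<Rightarrow> 'g \<Rightarrow> 'a \<Rightarrow> 'a" where
  "Ad A mul invs \<iota> g \<eta> =
     (THE \<zeta>. \<iota> \<zeta> = pushforward A (\<lambda>h. mul (mul g h) (invs g)) (\<iota> \<eta>))"

text \<open>\<open>W\<close> is the neighbourhood of \<open>0\<close> on which \<open>\<tau>\<close> is a diffeomorphism.\<close>

definition lie_retraction ::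
  "('g::topological_space, 'm::euclidean_space) chart set \<Rightarrow> ('g \<Rightarrow> 'g \<Rightarrow> 'g) \<Rightarrow> 'g \<Rightarrow>
   'a::euclidean_space set \<Rightarrow> ('a \<Rightarrow> 'g) \<Rightarrow> bool" where
  "lie_retraction A mul e W \<tau> \<longleftrightarrow>
     0 \<in> W \<and> (\<exists>V. e \<in> V \<and> analytic_diffeo flat_atlas A W V \<tau>) \<and>
     (\<forall>\<xi>. mul (\<tau> \<xi>) (\<tau> (- \<xi>)) = e)"

text \<open>The right-trivialized tangent: \<open>\<partial>\<^sub>\<xi> \<tau>(\<xi>) \<eta> = (d\<tau>\<^sub>\<xi> \<eta>) \<tau>(\<xi>)\<close>.\<close>

definition dtau ::
  "('g::topological_space, 'm::euclidean_space) chart set \<Rightarrow> ('g \<Rightarrow> 'g \<Rightarrow> 'g) \<Rightarrow>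
   ('a::euclidean_space \<Rightarrow> (('g \<Rightarrow> real) \<Rightarrow> real)) \<Rightarrow> ('a \<Rightarrow> 'g) \<Rightarrow> 'a \<Rightarrow> 'a \<Rightarrow> 'a" where
  "dtau A mul \<iota> \<tau> \<xi> \<eta> =
     (THE \<zeta>. tangent_of_map A \<tau> \<xi> \<eta> = pushforward A (\<lambda>h. mul h (\<tau> \<xi>)) (\<iota> \<zeta>))"

definition dtau_inv ::
  "('g::topological_space, 'm::euclidean_space) chart set \<Rightarrow> ('g \<Rightarrow> 'g \<Rightarrow> 'g) \<Rightarrow>
   ('a::euclidean_space \<Rightarrow> (('g \<Rightarrow> real) \<Rightarrow> real)) \<Rightarrow> ('a \<Rightarrow> 'g) \<Rightarrow> 'a \<Rightarrow> 'a \<Rightarrow> 'a" where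
  "dtau_inv A mul \<iota> \<tau> \<xi> = inv (dtau A mul \<iota> \<tau> \<xi>)"

text \<open>The dual space of \<open>'a\<close> is \<open>'a \<Rightarrow>\<^sub>L real\<close>.\<close>

definition dual_map :: "('a::euclidean_space \<Rightarrow> 'a) \<Rightarrow> ('a \<Rightarrow>\<^sub>L real) \<Rightarrow> ('a \<Rightarrow>\<^sub>L real)" where
  "dual_map T \<mu> = Blinfun (\<lambda>\<eta>. blinfun_apply \<mu> (T \<eta>))"

definition differential :: "('a::euclidean_space \<Rightarrow> real) \<Rightarrow> 'a \<Rightarrow> ('a \<Rightarrow>\<^sub>L real)" where
  "differential l \<xi> = Blinfun (frechet_derivative l (at \<xi>))"


section \<open>Discrete Euler-Poincare-Suslov systems\<close>

definition constraint_space :: "nat \<Rightarrow> (nat \<Rightarrow> 'a::euclidean_space \<Rightarrow>\<^sub>L real) \<Rightarrow> 'a set" where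
  "constraint_space m a = {\<xi>. \<forall>\<alpha>\<in>{1..m}. blinfun_apply (a \<alpha>) \<xi> = 0}"

text \<open>The discrete constraint submanifold is \<open>{(g, h). g\<^sup>-\<^sup>1 h \<in> S}\<close>.\<close>

definition displacement_subvariety ::
  "('g::topological_space, 'm::euclidean_space) chart set \<Rightarrow> 'g \<Rightarrow> nat \<Rightarrow>
   (nat \<Rightarrow> 'g \<Rightarrow> real) \<Rightarrow> 'g set \<Rightarrow> bool" where
  "displacement_subvariety A e m \<phi> S \<longleftrightarrow>
     submanifold A m S \<and> e \<in> S \<and> (\<forall>\<alpha>\<in>{1..m}. \<phi> \<alpha> \<in> smooth_functions A) \<and>
     S = {g. \<forall>\<alpha>\<in>{1..m}. \<phi> \<alpha> g = 0}"

definition delta_xi ::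
  "('g::topological_space, 'm::euclidean_space) chart set \<Rightarrow> ('g \<Rightarrow> 'g \<Rightarrow> 'g) \<Rightarrow> ('g \<Rightarrow> 'g) \<Rightarrow>
   ('a::euclidean_space \<Rightarrow> (('g \<Rightarrow> real) \<Rightarrow> real)) \<Rightarrow> ('a \<Rightarrow> 'g) \<Rightarrow> real \<Rightarrow>
   (nat \<Rightarrow> 'a) \<Rightarrow> (nat \<Rightarrow> 'a) \<Rightarrow> nat \<Rightarrow> 'a" where
  "delta_xi A mul invs \<iota> \<tau> \<epsilon> \<xi> \<eta> k =
     (1 / \<epsilon>) *\<^sub>R dtau_inv A mul \<iota> \<tau> (\<epsilon> *\<^sub>R \<xi> k)
       (- \<eta> k + Ad A mul invs \<iota> (\<tau> (\<epsilon> *\<^sub>R \<xi> k)) (\<eta> (k + 1)))"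

definition critical_point ::
  "('g::topological_space, 'm::euclidean_space) chart set \<Rightarrow> ('g \<Rightarrow> 'g \<Rightarrow> 'g) \<Rightarrow> ('g \<Rightarrow> 'g) \<Rightarrow>
   ('a::euclidean_space \<Rightarrow> (('g \<Rightarrow> real) \<Rightarrow> real)) \<Rightarrow> ('a \<Rightarrow> 'g) \<Rightarrow> real \<Rightarrow> nat \<Rightarrow>
   ('a \<Rightarrow> real) \<Rightarrow> 'a set \<Rightarrow> (nat \<Rightarrow> 'a) \<Rightarrow> bool" where
  "critical_point A mul invs \<iota> \<tau> \<epsilon> N l D \<xi> \<longleftrightarrow>
     (\<forall>\<eta>. (\<forall>k\<in>{0..N}. \<eta> k \<in> D) \<and> \<eta> 0 = 0 \<and> \<eta> N = 0 \<longrightarrow>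
        (\<Sum>k = 0..N - 1.
           blinfun_apply (differential l (\<xi> k)) (delta_xi A mul invs \<iota> \<tau> \<epsilon> \<xi> \<eta> k)) = 0)"

end

theory Submission
  imports Defs
begin

text \<open>
  Differentiating \<open>\<tau>(x) \<tau>(-x) = e\<close> gives \<open>d\<tau>\<^sub>\<xi> = Ad\<^bsub>\<tau>(\<xi>)\<^esub> \<circ> d\<tau>\<^bsub>-\<xi>\<^esub>\<close>, so the variations are
  \<open>\<delta>\<xi>\<^sub>k = (d\<tau>\<^sup>-\<^sup>1\<^bsub>-\<epsilon>\<xi>\<^sub>k\<^esub> \<eta>\<^sub>k\<^sub>+\<^sub>1 - d\<tau>\<^sup>-\<^sup>1\<^bsub>\<epsilon>\<xi>\<^sub>k\<^esub> \<eta>\<^sub>k) / \<epsilon>\<close>.  Summation by parts turns the variation of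
  the action into a sum of pairings of the Euler-Poincare-Suslov expressions with the free vectors
  \<open>\<eta>\<^sub>1, \<dots>, \<eta>\<^bsub>N-1\<^esub>\<close> of the constraint space, and a functional vanishes on that space iff it is a
  combination of the \<open>a\<^sup>\<alpha>\<close>.

  That \<open>d\<tau>\<^sub>\<xi>\<close> is bijective needs no description of the derivations at \<open>e\<close>: the isomorphism \<open>\<iota>\<close> makes it
  an endomorphism of a finite-dimensional space, and bump functions supported in \<open>\<tau>(W)\<close> show that
  it is injective.
\<close>

section \<open>Calculus of smooth maps\<close>

text \<open>Openness matters because derivatives are taken at \<open>x\<close> in the full space:
  agreement on \<open>S\<close> must mean agreement near each of its points.\<close>

lemma Cn_on_cong:
  assumes "Cn_on n S f" "open S" "\<And>x. x \<in> S \<Longrightarrow> f x = g x"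
  shows "Cn_on n S g"
proof (cases n)
  case 0
  then show ?thesis using assms by (auto cong: continuous_on_cong)
next
  case (Suc k)
  then obtain f' where f': "\<And>x. x \<in> S \<Longrightarrow> (f has_derivative f' x) (at x)"
    "\<And>v. Cn_on k S (\<lambda>x. f' x v)"
    using assms(1) by auto
  have "(g has_derivative f' x) (at x)" if "x \<in> S" for x
    using has_derivative_transform_within_open[OF f'(1)[OF that] assms(2) that assms(3)] by simp
  then show ?thesis using Suc f'(2) by auto
qed

text \<open>Derivatives are unique, so the witness \<open>f'\<close> can always be replaced by the
  canonical \<open>frechet_derivative\<close>. Removing the existential is what allows local
  information to be glued.\<close>

lemma Cn_on_Suc_open:
  assumes "open S"
  shows "Cn_on (Suc n) S f \<longleftrightarrow>
    (\<forall>x\<in>S. f differentiable (at x)) \<and> (\<forall>v. Cn_on n S (\<lambda>x. frechet_derivative f (at x) v))"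
proof
  assume "Cn_on (Suc n) S f"
  then obtain f' where f': "\<And>x. x \<in> S \<Longrightarrow> (f has_derivative f' x) (at x)"
    "\<And>v. Cn_on n S (\<lambda>x. f' x v)"
    by auto
  have "Cn_on n S (\<lambda>x. frechet_derivative f (at x) v)" for v
    by (rule Cn_on_cong[OF f'(2)[of v] assms]) (metis f'(1) frechet_derivative_at)
  then show "(\<forall>x\<in>S. f differentiable (at x)) \<and>
      (\<forall>v. Cn_on n S (\<lambda>x. frechet_derivative f (at x) v))"
    using f'(1) differentiableI by blast
next
  assume "(\<forall>x\<in>S. f differentiable (at x)) \<and> (\<forall>v. Cn_on n S (\<lambda>x. frechet_derivative f (at x) v))"
  then show "Cn_on (Suc n) S f"
    by (auto simp: frechet_derivative_works intro!: exI[of _ "\<lambda>x. frechet_derivative f (at x)"])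
qed

text \<open>Different neighbourhoods supply different derivative witnesses; passing to
  \<open>frechet_derivative\<close> makes them one global function, to which the induction
  hypothesis applies. Smoothness on manifolds is later verified around one point at a time with
  this.\<close>

lemma Cn_on_local:
  assumes "\<And>x. x \<in> S \<Longrightarrow> \<exists>T. open T \<and> x \<in> T \<and> Cn_on n T f"
  shows "Cn_on n S f"
  using assms
proof (induction n arbitrary: f)
  case 0
  then have "continuous (at x within S) f" if "x \<in> S" for x
    using that by (metis Cn_on.simps(1) continuous_at_imp_continuous_at_within
        continuous_on_eq_continuous_at)
  then show ?case by (simp add: continuous_on_eq_continuous_within)
next
  case (Suc n)
  have "f differentiable (at x)" if x: "x \<in> S" for x
    using Suc.prems[OF x] Cn_on_Suc_open by blast
  moreover have "Cn_on n S (\<lambda>x. frechet_derivative f (at x) v)" for v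
  proof (rule Suc.IH)
    fix x assume "x \<in> S"
    from Suc.prems[OF this] show "\<exists>T. open T \<and> x \<in> T \<and> Cn_on n T (\<lambda>x. frechet_derivative f (at x) v)"
      using Cn_on_Suc_open by blast
  qed
  ultimately show ?case
    by (auto simp: frechet_derivative_works intro!: exI[of _ "\<lambda>x. frechet_derivative f (at x)"])
qed

lemma Cn_on_SucD: "Cn_on (Suc n) S f \<Longrightarrow> Cn_on n S f"
proof (induction n arbitrary: f)
  case 0
  then have "isCont f x" if "x \<in> S" for x
    using that has_derivative_continuous by fastforce
  then show ?case by (simp add: continuous_at_imp_continuous_on)
next
  case (Suc n)
  then obtain f' where f': "\<And>x. x \<in> S \<Longrightarrow> (f has_derivative f' x) (at x)"
    "\<And>v. Cn_on (Suc n) S (\<lambda>x. f' x v)"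
    by (metis Cn_on.simps(2))
  then show ?case using Suc.IH[OF f'(2)] by auto
qed

section \<open>Closure properties of class C^n\<close>

lemma Cn_on_const: "Cn_on n S (\<lambda>x. c)"
proof (induction n arbitrary: c)
  case (Suc n)
  then show ?case by (auto intro!: exI[of _ "\<lambda>x v. 0"])
qed auto

lemma Cn_on_bounded_linear:
  assumes "bounded_linear L" "Cn_on n S f"
  shows "Cn_on n S (\<lambda>x. L (f x))"
  using assms(2)
proof (induction n arbitrary: f)
  case 0
  then show ?case using assms(1) by (auto intro: linear_continuous_on_compose bounded_linear.continuous_on)
next
  case (Suc n)
  then obtain f' where f': "\<And>x. x \<in> S \<Longrightarrow> (f has_derivative f' x) (at x)"
    "\<And>v. Cn_on n S (\<lambda>x. f' x v)"
    by auto
  then show ?case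
    using Suc.IH[OF f'(2)] bounded_linear.has_derivative[OF assms(1) f'(1)]
    by (auto intro!: exI[of _ "\<lambda>x v. L (f' x v)"])
qed

lemma Cn_on_id: "Cn_on n S (\<lambda>x. x)"
proof (cases n)
  case (Suc k)
  then show ?thesis using Cn_on_const by (auto intro!: exI[of _ "\<lambda>x v. v"])
qed auto

lemma Cn_on_add:
  assumes "Cn_on n S f" "Cn_on n S g"
  shows "Cn_on n S (\<lambda>x. f x + g x)"
  using assms
proof (induction n arbitrary: f g)
  case 0
  then show ?case by (auto intro: continuous_on_add)
next
  case (Suc n)
  obtain f' where f': "\<And>x. x \<in> S \<Longrightarrow> (f has_derivative f' x) (at x)"
    "\<And>v. Cn_on n S (\<lambda>x. f' x v)"
    using Suc.prems by auto
  obtain g' where g': "\<And>x. x \<in> S \<Longrightarrow> (g has_derivative g' x) (at x)"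
    "\<And>v. Cn_on n S (\<lambda>x. g' x v)"
    using Suc.prems by auto
  show ?case
    using Suc.IH[OF f'(2) g'(2)] has_derivative_add[OF f'(1) g'(1)]
    by (auto intro!: exI[of _ "\<lambda>x v. f' x v + g' x v"])
qed

lemma Cn_on_sum:
  assumes "\<And>i. i \<in> I \<Longrightarrow> Cn_on n S (f i)"
  shows "Cn_on n S (\<lambda>x. \<Sum>i\<in>I. f i x)"
proof (cases "finite I")
  case True
  then show ?thesis using assms
    by (induction I rule: finite_induct) (auto intro: Cn_on_const Cn_on_add)
qed (auto intro: Cn_on_const)

lemma Cn_on_bounded_bilinear:
  assumes "bounded_bilinear B" "Cn_on n S f" "Cn_on n S g"
  shows "Cn_on n S (\<lambda>x. B (f x) (g x))"
  using assms(2,3)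
proof (induction n arbitrary: f g)
  case 0
  then show ?case by (auto intro: bounded_bilinear.continuous_on[OF assms(1)])
next
  case (Suc n)
  obtain f' where f': "\<And>x. x \<in> S \<Longrightarrow> (f has_derivative f' x) (at x)"
    "\<And>v. Cn_on n S (\<lambda>x. f' x v)"
    using Suc.prems by auto
  obtain g' where g': "\<And>x. x \<in> S \<Longrightarrow> (g has_derivative g' x) (at x)"
    "\<And>v. Cn_on n S (\<lambda>x. g' x v)"
    using Suc.prems by auto
  show ?case
    \<comment> \<open>In the product rule one factor stays undifferentiated. It has order
      \<open>Suc n\<close>, one more than the induction hypothesis takes, hence the use of
      \<open>Cn_on_SucD\<close>.\<close>
    using Cn_on_add[OF Suc.IH[OF Cn_on_SucD[OF Suc.prems(1)] g'(2)]
        Suc.IH[OF f'(2) Cn_on_SucD[OF Suc.prems(2)]]]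
      bounded_bilinear.FDERIV[OF assms(1) f'(1) g'(1)]
    by (auto intro!: exI[of _ "\<lambda>x v. B (f x) (g' x v) + B (f' x v) (g x)"])
qed

lemma Cn_on_compose:
  fixes g :: "'a::real_normed_vector \<Rightarrow> 'b::euclidean_space"
  assumes "Cn_on n T f" "Cn_on n S g" "g ` S \<subseteq> T"
  shows "Cn_on n S (f \<circ> g)"
  using assms
proof (induction n arbitrary: f)
  case 0
  then show ?case using continuous_on_compose continuous_on_subset unfolding Cn_on.simps by blast
next
  case (Suc n)
  obtain f' where f': "\<And>x. x \<in> T \<Longrightarrow> (f has_derivative f' x) (at x)"
    "\<And>v. Cn_on n T (\<lambda>x. f' x v)"
    using Suc.prems by auto
  obtain g' where g': "\<And>x. x \<in> S \<Longrightarrow> (g has_derivative g' x) (at x)"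
    "\<And>v. Cn_on n S (\<lambda>x. g' x v)"
    using Suc.prems(2) by auto
  \<comment> \<open>The chain rule gives \<open>f' (g x) (g' x v)\<close>, whose direction varies
    with \<open>x\<close>, while regularity of \<open>f'\<close> is known only for fixed directions.
    Expanding \<open>g' x v\<close> in the basis leaves fixed directions with variable
    coefficients.\<close>
  define h where "h x v = (\<Sum>b\<in>Basis. (g' x v \<bullet> b) *\<^sub>R f' (g x) b)" for x v
  have "((f \<circ> g) has_derivative h x) (at x)" if "x \<in> S" for x
  proof -
    have f'x: "(f has_derivative f' (g x)) (at (g x))" using f'(1) Suc.prems(3) that by blast
    then interpret L: bounded_linear "f' (g x)" by (rule has_derivative_bounded_linear)
    have "f' (g x) (g' x v) = h x v" for v
      unfolding h_def
      by (subst euclidean_representation[symmetric, of "g' x v"]) (simp only: L.sum L.scaleR)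
    then show ?thesis
      using diff_chain_at[OF g'(1)[OF that] f'x] by (simp add: o_def)
  qed
  moreover have "Cn_on n S (\<lambda>x. h x v)" for v
    unfolding h_def
    using Suc.IH[OF f'(2) Cn_on_SucD[OF Suc.prems(2)] Suc.prems(3)]
    by (intro Cn_on_sum Cn_on_bounded_bilinear[OF bounded_bilinear_scaleR]
        Cn_on_bounded_linear[OF bounded_linear_inner_left] g'(2)) (simp add: o_def)
  ultimately show ?case unfolding Cn_on.simps by blast
qed

section \<open>Passage from class C^n to smooth maps\<close>

lemma smooth_on_compose:
  fixes g :: "'a::real_normed_vector \<Rightarrow> 'b::euclidean_space"
  assumes "smooth_on T f" "smooth_on S g" "g ` S \<subseteq> T"
  shows "smooth_on S (f \<circ> g)"
  using assms Cn_on_compose unfolding smooth_on_def by blast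

lemma smooth_on_cong:
  "smooth_on S f \<Longrightarrow> open S \<Longrightarrow> (\<And>x. x \<in> S \<Longrightarrow> f x = g x) \<Longrightarrow> smooth_on S g"
  using Cn_on_cong unfolding smooth_on_def by blast

lemma smooth_on_local:
  assumes "\<And>x. x \<in> S \<Longrightarrow> \<exists>T. open T \<and> x \<in> T \<and> smooth_on T f"
  shows "smooth_on S f"
  using assms Cn_on_local unfolding smooth_on_def by metis

lemma smooth_on_imp_continuous_on: "smooth_on S f \<Longrightarrow> continuous_on S f"
  unfolding smooth_on_def by (metis Cn_on.simps(1))

lemma smooth_on_imp_differentiable: "smooth_on S f \<Longrightarrow> x \<in> S \<Longrightarrow> f differentiable (at x)"
  unfolding smooth_on_def by (metis Cn_on.simps(2) differentiableI)

lemma smooth_on_const: "smooth_on S (\<lambda>x. c)"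
  by (simp add: smooth_on_def Cn_on_const)

lemma smooth_on_bounded_linear: "bounded_linear L \<Longrightarrow> smooth_on S f \<Longrightarrow> smooth_on S (\<lambda>x. L (f x))"
  by (simp add: smooth_on_def Cn_on_bounded_linear)

lemma smooth_on_id: "smooth_on S (\<lambda>x. x)"
  by (simp add: smooth_on_def Cn_on_id)

lemma smooth_on_add: "smooth_on S f \<Longrightarrow> smooth_on S g \<Longrightarrow> smooth_on S (\<lambda>x. f x + g x)"
  by (simp add: smooth_on_def Cn_on_add)

lemma smooth_on_bounded_bilinear:
  "bounded_bilinear B \<Longrightarrow> smooth_on S f \<Longrightarrow> smooth_on S g \<Longrightarrow> smooth_on S (\<lambda>x. B (f x) (g x))"
  by (simp add: smooth_on_def Cn_on_bounded_bilinear)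

section \<open>A smooth function that is flat at the origin\<close>

text \<open>Index 0 is the classical function exp(-1/x). The extra powers of 1/x make the family
  closed under differentiation up to linear combinations.\<close>

definition flat_exp :: "nat \<Rightarrow> real \<Rightarrow> real" where
  "flat_exp k x = (if x > 0 then (1 / x) ^ k * exp (- (1 / x)) else 0)"

text \<open>With y = 1/x this is the fact that the exponential outgrows every power of y at
  infinity.\<close>

lemma flat_exp_at_right: "(flat_exp k \<longlongrightarrow> 0) (at_right 0)"
proof -
  have "((\<lambda>x::real. inverse x ^ k / exp (inverse x)) \<longlongrightarrow> 0) (at_right 0)"
    by (rule filterlim_compose[OF tendsto_power_div_exp_0 filterlim_inverse_at_top_right])
  moreover have "\<forall>\<^sub>F x::real in at_right 0. inverse x ^ k / exp (inverse x) = flat_exp k x"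
    using eventually_at_right_less
    by eventually_elim (simp add: flat_exp_def exp_minus divide_inverse)
  ultimately show ?thesis by (rule Lim_transform_eventually)
qed

lemma flat_exp_DERIV:
  "(flat_exp k has_real_derivative - real k * flat_exp (Suc k) x + flat_exp (Suc (Suc k)) x) (at x)"
proof (cases x "0::real" rule: linorder_cases)
  case less
  have "((\<lambda>x. 0) has_real_derivative 0) (at x)" by simp
  then have "(flat_exp k has_real_derivative 0) (at x)"
    by (rule has_field_derivative_transform_within_open[where S = "{..<0}"])
      (use less in \<open>auto simp: flat_exp_def\<close>)
  then show ?thesis using less by (simp add: flat_exp_def)
next
  case equal
  have "((\<lambda>h. (flat_exp k h - flat_exp k 0) / h) \<longlongrightarrow> 0) (at 0)"
  proof (rule filterlim_split_at)
    show "((\<lambda>h. (flat_exp k h - flat_exp k 0) / h) \<longlongrightarrow> 0) (at_left 0)"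
      by (rule tendsto_eventually) (auto simp: eventually_at_filter flat_exp_def)
    \<comment> \<open>The value at 0 is 0, so dividing by \<open>h\<close> merely raises the power
      of \<open>1 / h\<close> by one, and the right-hand limit is known for every index.\<close>
    have "\<forall>\<^sub>F h in at_right 0. flat_exp (Suc k) h = (flat_exp k h - flat_exp k 0) / h"
      using eventually_at_right_less by eventually_elim (simp add: flat_exp_def)
    then show "((\<lambda>h. (flat_exp k h - flat_exp k 0) / h) \<longlongrightarrow> 0) (at_right 0)"
      by (rule Lim_transform_eventually[OF flat_exp_at_right])
  qed
  then show ?thesis using equal
    by (simp add: DERIV_def) (simp add: flat_exp_def)
next
  case greater
  have "((\<lambda>x. (1 / x) ^ k * exp (- (1 / x))) has_real_derivative
      - real k * flat_exp (Suc k) x + flat_exp (Suc (Suc k)) x) (at x)"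
  \<comment> \<open>The power rule lowers the exponent to \<open>k - 1\<close>, which is truncated
    at 0, so \<open>k = 0\<close> is treated separately.\<close>
  proof (cases k)
    case 0
    show ?thesis unfolding 0 using greater
      by (auto intro!: derivative_eq_intros simp: flat_exp_def power2_eq_square)
  next
    case (Suc j)
    show ?thesis unfolding Suc using greater
      by (auto intro!: derivative_eq_intros simp del: power_Suc of_nat_Suc)
        (simp add: flat_exp_def field_simps)
  qed
  then show ?thesis
    by (rule has_field_derivative_transform_within_open[where S = "{0<..}"])
      (use greater in \<open>auto simp: flat_exp_def\<close>)
qed

lemma smooth_on_flat_exp: "smooth_on S (flat_exp k)"
proof -
  have "Cn_on n S (flat_exp k)" for n
  \<comment> \<open>The derivative at index \<open>k\<close> involves the indices
    \<open>k + 1\<close> and \<open>k + 2\<close>, so all indices are handled at once.\<close>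
  proof (induction n arbitrary: k)
    case 0
    show ?case
      by (auto intro!: continuous_at_imp_continuous_on DERIV_isCont flat_exp_DERIV)
  next
    case (Suc n)
    have "Cn_on n S (\<lambda>x. (- real k * flat_exp (Suc k) x + flat_exp (Suc (Suc k)) x) * v)" for v
      by (intro Cn_on_bounded_bilinear[OF bounded_bilinear_mult] Cn_on_add Cn_on_const Suc)
    then show ?case
      using flat_exp_DERIV[of k]
      by (auto simp: has_field_derivative_def intro!: exI[of _ "\<lambda>x v. (- real k * flat_exp (Suc k) x + flat_exp (Suc (Suc k)) x) * v"])
  qed
  then show ?thesis by (simp add: smooth_on_def)
qed

section \<open>Smooth functions on manifolds and Lie groups\<close>

lemma smooth_on_Pair:
  assumes "smooth_on S f" "smooth_on S g"
  shows "smooth_on S (\<lambda>x. (f x, g x))"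
proof -
  have "bounded_linear (\<lambda>u::'b. (u, 0::'c))" "bounded_linear (\<lambda>v::'c. (0::'b, v))"
    by (auto intro!: bounded_linear_Pair bounded_linear_ident bounded_linear_zero)
  then have "smooth_on S (\<lambda>x. (f x, 0) + (0, g x))"
    using assms by (intro smooth_on_add) (auto intro: smooth_on_bounded_linear)
  then show ?thesis by simp
qed

section \<open>Charts, products of charts and smooth functions\<close>

lemma is_chartD:
  assumes "is_chart (U, \<phi>)"
  shows "open U" "open (\<phi> ` U)" "inj_on \<phi> U" "homeomorphism U (\<phi> ` U) \<phi> (inv_into U \<phi>)"
  using assms by (auto simp: is_chart_def homeomorphism_def intro!: inj_on_inverseI[of U "inv_into U \<phi>"])

lemma is_chart_open_image:
  assumes "is_chart (U, \<phi>)" "open T" "T \<subseteq> U"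
  shows "open (\<phi> ` T)"
proof -
  have "openin (top_of_set (\<phi> ` U)) (\<phi> ` T)"
    by (rule homeomorphism_imp_open_map[OF is_chartD(4)[OF assms(1)]])
      (use assms is_chartD(1)[OF assms(1)] in \<open>auto simp: openin_open_eq\<close>)
  then show ?thesis
    using is_chartD(2)[OF assms(1)] by (metis openin_open_eq)
qed

text \<open>\<open>prod_atlas\<close> only forms pairs; that they are charts is used to read the
  group multiplication in coordinates.\<close>

lemma is_chart_Times:
  assumes "is_chart (U, \<phi>)" "is_chart (V, \<psi>)"
  shows "is_chart (U \<times> V, map_prod \<phi> \<psi>)"
proof -
  note h = is_chartD(4)[OF assms(1)] is_chartD(4)[OF assms(2)]
  have inj: "inj_on (map_prod \<phi> \<psi>) (U \<times> V)"
    using is_chartD(3)[OF assms(1)] is_chartD(3)[OF assms(2)] by (rule map_prod_inj_on)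
  have img: "map_prod \<phi> \<psi> ` (U \<times> V) = \<phi> ` U \<times> \<psi> ` V" by auto
  have inv: "inv_into (U \<times> V) (map_prod \<phi> \<psi>) z = (inv_into U \<phi> (fst z), inv_into V \<psi> (snd z))"
    if "z \<in> \<phi> ` U \<times> \<psi> ` V" for z
    using that by (intro inv_into_f_eq[OF inj]) (auto simp: inv_into_into f_inv_into_f)
  have "continuous_on (\<phi> ` U \<times> \<psi> ` V) (\<lambda>z. (inv_into U \<phi> (fst z), inv_into V \<psi> (snd z)))"
    using h by (auto simp: homeomorphism_def intro!: continuous_on_Pair
        continuous_on_compose2[OF _ continuous_on_fst] continuous_on_compose2[OF _ continuous_on_snd]
        continuous_on_id)
  then have ci: "continuous_on (\<phi> ` U \<times> \<psi> ` V) (inv_into (U \<times> V) (map_prod \<phi> \<psi>))"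
    by (subst continuous_on_cong[OF refl inv])
  have "continuous_on (U \<times> V) (\<lambda>z. (\<phi> (fst z), \<psi> (snd z)))"
    using h by (auto simp: homeomorphism_def intro!: continuous_on_Pair
        continuous_on_compose2[OF _ continuous_on_fst] continuous_on_compose2[OF _ continuous_on_snd]
        continuous_on_id)
  then have "continuous_on (U \<times> V) (map_prod \<phi> \<psi>)"
    by (simp add: map_prod_def case_prod_beta)
  then have "homeomorphism (U \<times> V) (\<phi> ` U \<times> \<psi> ` V) (map_prod \<phi> \<psi>) (inv_into (U \<times> V) (map_prod \<phi> \<psi>))"
    using ci inj
    by (intro homeomorphismI) (auto simp: inv inv_into_f_f f_inv_into_f inv_into_into)
  then show ?thesis
    using is_chartD(1,2)[OF assms(1)] is_chartD(1,2)[OF assms(2)]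
    by (simp add: is_chart_def img open_Times)
qed

lemma analytic_atlasD:
  assumes "analytic_atlas A"
  shows "(U, \<phi>) \<in> A \<Longrightarrow> is_chart (U, \<phi>)" "\<exists>U \<phi>. (U, \<phi>) \<in> A \<and> p \<in> U"
proof -
  show "(U, \<phi>) \<in> A \<Longrightarrow> is_chart (U, \<phi>)" using assms unfolding analytic_atlas_def by blast
  have "p \<in> (\<Union>(U, \<phi>)\<in>A. U)" using assms unfolding analytic_atlas_def by blast
  then show "\<exists>U \<phi>. (U, \<phi>) \<in> A \<and> p \<in> U" by auto
qed

lemma analytic_map_imp_smooth_map: "analytic_map A B S f \<Longrightarrow> smooth_map A B S f"
  unfolding regular_map_def real_analytic_on_def by blast

text \<open>The target has a single chart, the identity, so no preimage has to be cut out.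
  Continuity follows from the coordinate expressions: on each chart domain \<open>f\<close> is one
  of them composed with a homeomorphism, and the open domains cover the manifold.\<close>

lemma smooth_functions_iff:
  assumes "analytic_atlas A"
  shows "f \<in> smooth_functions A \<longleftrightarrow> (\<forall>(U, \<phi>)\<in>A. smooth_on (\<phi> ` U) (f \<circ> inv_into U \<phi>))"
proof
  assume "f \<in> smooth_functions A"
  then show "\<forall>(U, \<phi>)\<in>A. smooth_on (\<phi> ` U) (f \<circ> inv_into U \<phi>)"
    by (simp add: smooth_functions_def regular_map_def flat_atlas_def)
next
  assume *: "\<forall>(U, \<phi>)\<in>A. smooth_on (\<phi> ` U) (f \<circ> inv_into U \<phi>)"
  have "continuous_on (\<Union>c\<in>A. fst c) f"
  proof (rule continuous_on_open_UN)
    fix c assume "c \<in> A"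
    then obtain U \<phi> where c: "(U, \<phi>) \<in> A" "c = (U, \<phi>)" by (cases c) auto
    note ch = is_chartD[OF analytic_atlasD(1)[OF assms c(1)]]
    show "open (fst c)" using ch(1) c(2) by simp
    have "continuous_on (\<phi> ` U) (f \<circ> inv_into U \<phi>)"
      using * c(1) smooth_on_imp_continuous_on by blast
    with homeomorphism_cont1[OF ch(4)] have "continuous_on U ((f \<circ> inv_into U \<phi>) \<circ> \<phi>)"
      by (rule continuous_on_compose)
    then have "continuous_on U f"
      by (rule continuous_on_eq) (use ch(3) in auto)
    then show "continuous_on (fst c) f" using c(2) by simp
  qed
  moreover have "(\<Union>c\<in>A. fst c) = UNIV"
    using analytic_atlasD(2)[OF assms] by force
  ultimately show "f \<in> smooth_functions A"
    using * by (simp add: smooth_functions_def regular_map_def flat_atlas_def)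
qed

text \<open>Near a given point the coordinate expression factors through a chart
  \<open>(V, \<psi>)\<close> around the image point. The factorization is valid only on the part
  \<open>T\<close> that \<open>F\<close> sends into \<open>V\<close>, so the argument is local. The
  source structure \<open>B\<close> is kept general to serve both the product atlas and the flat
  one.\<close>

lemma smooth_functions_comp_chart:
  assumes A: "analytic_atlas A" and f: "f \<in> smooth_functions A"
    and F: "smooth_map B A S F" and U: "(U, \<phi>) \<in> B" "is_chart (U, \<phi>)"
  shows "smooth_on (\<phi> ` (S \<inter> U)) (f \<circ> F \<circ> inv_into U \<phi>)"
proof (rule smooth_on_local)
  fix x assume "x \<in> \<phi> ` (S \<inter> U)"
  then obtain p where p: "p \<in> S" "p \<in> U" "x = \<phi> p" by blast
  obtain V \<psi> where V: "(V, \<psi>) \<in> A" "F p \<in> V" using analytic_atlasD(2)[OF A] by blast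
  note chU = is_chartD[OF U(2)] and chV = is_chartD[OF analytic_atlasD(1)[OF A V(1)]]
  define T where "T = S \<inter> U \<inter> F -` V"
  have "open (S \<inter> F -` V)"
    using F chV(1) by (auto simp: regular_map_def intro: continuous_open_preimage)
  then have "open (S \<inter> F -` V \<inter> U)" using chU(1) by (rule open_Int)
  then have "open T" by (simp add: T_def Int_ac)
  then have o: "open (\<phi> ` T)" by (rule is_chart_open_image[OF U(2)]) (auto simp: T_def)
  have g: "smooth_on (\<phi> ` T) (\<psi> \<circ> F \<circ> inv_into U \<phi>)"
    using F U(1) V(1) unfolding regular_map_def T_def by blast
  have fV: "smooth_on (\<psi> ` V) (f \<circ> inv_into V \<psi>)"
    using f V(1) smooth_functions_iff[OF A] by blast
  have "smooth_on (\<phi> ` T) ((f \<circ> inv_into V \<psi>) \<circ> (\<psi> \<circ> F \<circ> inv_into U \<phi>))"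
    by (rule smooth_on_compose[OF fV g]) (use chU(3) in \<open>auto simp: T_def inv_into_f_f\<close>)
  then have "smooth_on (\<phi> ` T) (f \<circ> F \<circ> inv_into U \<phi>)"
    by (rule smooth_on_cong[OF _ o]) (use chU(3) chV(3) in \<open>auto simp: T_def inv_into_f_f\<close>)
  then show "\<exists>T. open T \<and> x \<in> T \<and> smooth_on T (f \<circ> F \<circ> inv_into U \<phi>)"
    using o p V(2) by (intro exI[of _ "\<phi> ` T"]) (auto simp: T_def)
qed

section \<open>The algebra of smooth functions and its translates\<close>

lemma smooth_functions_add:
  assumes "analytic_atlas A" "f \<in> smooth_functions A" "g \<in> smooth_functions A"
  shows "(\<lambda>x. f x + g x) \<in> smooth_functions A"
  using assms by (auto simp: smooth_functions_iff o_def intro!: smooth_on_add)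

lemma smooth_functions_mult:
  assumes "analytic_atlas A" "f \<in> smooth_functions A" "g \<in> smooth_functions A"
  shows "(\<lambda>x. f x * g x) \<in> smooth_functions A"
  using assms
  by (auto simp: smooth_functions_iff o_def intro!: smooth_on_bounded_bilinear[OF bounded_bilinear_mult])

lemma smooth_functions_cmult:
  assumes "analytic_atlas A" "f \<in> smooth_functions A"
  shows "(\<lambda>x. c * f x) \<in> smooth_functions A"
  using assms
  by (auto simp: smooth_functions_iff o_def intro!: smooth_on_bounded_linear[OF bounded_linear_mult_right])

lemma pushforward_in_tangent_space:
  assumes "analytic_atlas A" "X \<in> tangent_space A p" "\<And>f. f \<in> smooth_functions A \<Longrightarrow> f \<circ> F \<in> smooth_functions A"
  shows "pushforward A F X \<in> tangent_space A (F p)"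
  using assms(2) assms(3) smooth_functions_add[OF assms(1)] smooth_functions_mult[OF assms(1)]
    smooth_functions_cmult[OF assms(1)]
  by (simp add: tangent_space_def pushforward_def o_def)

locale lie_group_space =
  fixes A :: "('g::{t2_space,second_countable_topology}, 'm::euclidean_space) chart set"
    and mul :: "'g \<Rightarrow> 'g \<Rightarrow> 'g" and e :: 'g and invs :: "'g \<Rightarrow> 'g"
  assumes lie_group: "lie_group A mul e invs"
begin

sublocale G: group mul e invs
  using lie_group by (simp add: lie_group_def)

lemma atlas: "analytic_atlas A"
  using lie_group by (simp add: lie_group_def)

text \<open>Joint smoothness in both factors is the common source for right and left translations,
  obtained by freezing one factor, and for the map (x, y) to \<tau>(x) \<tau>(y), differentiated
  later.\<close>

lemma smooth_on_mul_charts: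
  assumes f: "f \<in> smooth_functions A" and U: "(U, \<phi>) \<in> A" and V: "(V, \<psi>) \<in> A"
  shows "smooth_on (\<phi> ` U \<times> \<psi> ` V) (\<lambda>(x, y). f (mul (inv_into U \<phi> x) (inv_into V \<psi> y)))"
proof -
  note cU = analytic_atlasD(1)[OF atlas U] and cV = analytic_atlasD(1)[OF atlas V]
  note ch = is_chart_Times[OF cU cV]
  have m: "smooth_map (prod_atlas A A) A UNIV (\<lambda>(g, h). mul g h)"
    using lie_group by (auto simp: lie_group_def intro: analytic_map_imp_smooth_map)
  have "(U \<times> V, map_prod \<phi> \<psi>) \<in> prod_atlas A A"
    using U V by (auto simp: prod_atlas_def)
  from smooth_functions_comp_chart[OF atlas f m this ch]
  have *: "smooth_on (map_prod \<phi> \<psi> ` (U \<times> V)) (f \<circ> (\<lambda>(g, h). mul g h) \<circ> inv_into (U \<times> V) (map_prod \<phi> \<psi>))"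
    by simp
  have img: "map_prod \<phi> \<psi> ` (U \<times> V) = \<phi> ` U \<times> \<psi> ` V" by auto
  have "inv_into (U \<times> V) (map_prod \<phi> \<psi>) (\<phi> u, \<psi> v) = (u, v)" if "u \<in> U" "v \<in> V" for u v
    using inv_into_f_f[OF is_chartD(3)[OF ch], of "(u, v)"] that by simp
  then show ?thesis
    using is_chartD(3)[OF cU] is_chartD(3)[OF cV]
    by (intro smooth_on_cong[OF *[unfolded img]] open_Times is_chartD(2)[OF cU] is_chartD(2)[OF cV])
      (auto simp: inv_into_f_f)
qed

lemma smooth_functions_right_translate:
  assumes f: "f \<in> smooth_functions A"
  shows "f \<circ> (\<lambda>h. mul h g) \<in> smooth_functions A"
  unfolding smooth_functions_iff[OF atlas]
proof clarify
  fix U \<phi> assume U: "(U, \<phi>) \<in> A"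
  obtain V \<psi> where V: "(V, \<psi>) \<in> A" "g \<in> V" using analytic_atlasD(2)[OF atlas] by blast
  \<comment> \<open>Right translation by \<open>g\<close> is the slice of the multiplication on
    which the second coordinate is the constant \<open>\<psi> g\<close>.\<close>
  have "smooth_on (\<phi> ` U) ((\<lambda>(x, y). f (mul (inv_into U \<phi> x) (inv_into V \<psi> y))) \<circ> (\<lambda>x. (x, \<psi> g)))"
    by (rule smooth_on_compose[OF smooth_on_mul_charts[OF f U V(1)] smooth_on_Pair[OF smooth_on_id smooth_on_const]])
      (use V in auto)
  then show "smooth_on (\<phi> ` U) (f \<circ> (\<lambda>h. mul h g) \<circ> inv_into U \<phi>)"
    using inv_into_f_f[OF is_chartD(3)[OF analytic_atlasD(1)[OF atlas V(1)]] V(2)] by (simp add: o_def)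
qed

lemma smooth_functions_left_translate:
  assumes f: "f \<in> smooth_functions A"
  shows "f \<circ> (\<lambda>h. mul g h) \<in> smooth_functions A"
  unfolding smooth_functions_iff[OF atlas]
proof clarify
  fix U \<phi> assume U: "(U, \<phi>) \<in> A"
  obtain V \<psi> where V: "(V, \<psi>) \<in> A" "g \<in> V" using analytic_atlasD(2)[OF atlas] by blast
  have "smooth_on (\<phi> ` U) ((\<lambda>(x, y). f (mul (inv_into V \<psi> x) (inv_into U \<phi> y))) \<circ> (\<lambda>x. (\<psi> g, x)))"
    by (rule smooth_on_compose[OF smooth_on_mul_charts[OF f V(1) U] smooth_on_Pair[OF smooth_on_const smooth_on_id]])
      (use V in auto)
  then show "smooth_on (\<phi> ` U) (f \<circ> (\<lambda>h. mul g h) \<circ> inv_into U \<phi>)"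
    using inv_into_f_f[OF is_chartD(3)[OF analytic_atlasD(1)[OF atlas V(1)]] V(2)] by (simp add: o_def)
qed

end

section \<open>The trivialized tangent of a retraction map\<close>

locale lie_group_retraction = lie_group_space A mul e invs
  for A :: "('g::{t2_space,second_countable_topology}, 'm::euclidean_space) chart set"
    and mul :: "'g \<Rightarrow> 'g \<Rightarrow> 'g" and e :: 'g and invs :: "'g \<Rightarrow> 'g" +
  fixes \<iota> :: "'a::euclidean_space \<Rightarrow> (('g \<Rightarrow> real) \<Rightarrow> real)"
    and \<tau> :: "'a \<Rightarrow> 'g" and W :: "'a set"
  assumes iso: "lie_algebra_iso A e \<iota>" and retraction: "lie_retraction A mul e W \<tau>"
begin

section \<open>Tangent vectors tested on smooth functions along the retraction\<close>

lemma \<iota>_in_tangent_space: "\<iota> \<zeta> \<in> tangent_space A e"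
  using iso by (auto simp: lie_algebra_iso_def bij_betw_def)

lemma \<iota>_not_smooth: "f \<notin> smooth_functions A \<Longrightarrow> \<iota> \<zeta> f = 0"
  using \<iota>_in_tangent_space by (auto simp: tangent_space_def)

lemma \<iota>_eqI:
  assumes "\<And>f. f \<in> smooth_functions A \<Longrightarrow> \<iota> \<zeta> f = \<iota> \<zeta>' f"
  shows "\<zeta> = \<zeta>'"
proof -
  have "\<iota> \<zeta> = \<iota> \<zeta>'" using assms \<iota>_not_smooth by (intro ext) metis
  then show ?thesis using iso by (auto simp: lie_algebra_iso_def bij_betw_def dest: injD)
qed

lemma open_W: "open W"
  using retraction by (auto simp: lie_retraction_def analytic_diffeo_def regular_map_def)

lemma smooth_map_\<tau>: "smooth_map flat_atlas A W \<tau>"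
  using retraction by (auto simp: lie_retraction_def analytic_diffeo_def intro: analytic_map_imp_smooth_map)

lemma continuous_on_\<tau>: "continuous_on W \<tau>"
  using smooth_map_\<tau> by (simp add: regular_map_def)

lemma inv_into_UNIV_id: "inv_into UNIV id = id"
  by (simp add: fun_eq_iff)

lemma smooth_on_comp_\<tau>: "f \<in> smooth_functions A \<Longrightarrow> smooth_on W (f \<circ> \<tau>)"
  using smooth_functions_comp_chart[OF atlas _ smooth_map_\<tau>, of f UNIV id]
  by (simp add: flat_atlas_def is_chart_def inv_into_UNIV_id homeomorphism_def)

lemma smooth_on_chart_\<tau>:
  assumes "(U, \<phi>) \<in> A"
  shows "open (W \<inter> \<tau> -` U)" "smooth_on (W \<inter> \<tau> -` U) (\<phi> \<circ> \<tau>)"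
proof -
  show "open (W \<inter> \<tau> -` U)"
    using continuous_on_\<tau> open_W is_chartD(1)[OF analytic_atlasD(1)[OF atlas assms]]
    by (rule continuous_open_preimage)
  show "smooth_on (W \<inter> \<tau> -` U) (\<phi> \<circ> \<tau>)"
    using smooth_map_\<tau> assms by (auto simp: regular_map_def flat_atlas_def inv_into_UNIV_id)
qed

lemma differentiable_comp_\<tau>:
  "f \<in> smooth_functions A \<Longrightarrow> \<xi> \<in> W \<Longrightarrow> (f \<circ> \<tau>) differentiable (at \<xi>)"
  using smooth_on_comp_\<tau> smooth_on_imp_differentiable by blast

lemma tangent_of_map_in_tangent_space:
  assumes "\<xi> \<in> W"
  shows "tangent_of_map A \<tau> \<xi> \<eta> \<in> tangent_space A (\<tau> \<xi>)"
proof -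
  have d: "(f \<circ> \<tau> has_derivative frechet_derivative (f \<circ> \<tau>) (at \<xi>)) (at \<xi>)"
    if "f \<in> smooth_functions A" for f
    using differentiable_comp_\<tau>[OF that assms] frechet_derivative_works by blast
  have "frechet_derivative ((\<lambda>x. f x + g x) \<circ> \<tau>) (at \<xi>) \<eta> =
      frechet_derivative (f \<circ> \<tau>) (at \<xi>) \<eta> + frechet_derivative (g \<circ> \<tau>) (at \<xi>) \<eta>"
    "frechet_derivative ((\<lambda>x. c * f x) \<circ> \<tau>) (at \<xi>) \<eta> = c * frechet_derivative (f \<circ> \<tau>) (at \<xi>) \<eta>"
    "frechet_derivative ((\<lambda>x. f x * g x) \<circ> \<tau>) (at \<xi>) \<eta> =
      f (\<tau> \<xi>) * frechet_derivative (g \<circ> \<tau>) (at \<xi>) \<eta> + frechet_derivative (f \<circ> \<tau>) (at \<xi>) \<eta> * g (\<tau> \<xi>)"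
    if fg: "f \<in> smooth_functions A" "g \<in> smooth_functions A" for f g c
    using frechet_derivative_at[OF has_derivative_add[OF d[OF fg(1)] d[OF fg(2)]], symmetric]
      frechet_derivative_at[OF has_derivative_mult_right[OF d[OF fg(1)], of c], symmetric]
      frechet_derivative_at[OF has_derivative_mult[OF d[OF fg(1)] d[OF fg(2)]], symmetric]
    by (simp_all add: o_def)
  then show ?thesis
    by (simp add: tangent_space_def tangent_of_map_def smooth_functions_add[OF atlas]
        smooth_functions_mult[OF atlas] smooth_functions_cmult[OF atlas])
qed

lemma mul_\<tau>_minus: "mul (\<tau> \<xi>) (\<tau> (- \<xi>)) = e" "mul (\<tau> (- \<xi>)) (\<tau> \<xi>) = e"
  using retraction unfolding lie_retraction_def by (metis minus_minus)+

lemma invs_\<tau>: "invs (\<tau> \<xi>) = \<tau> (- \<xi>)"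
  using mul_\<tau>_minus(1) G.inverse_unique by blast

text \<open>\<open>dtau\<close> is a definite description, so existence and uniqueness are due.
  Right translation by \<tau>(-\<xi>) carries the tangent vector at \<tau>(\<xi>) back to
  \<open>e\<close>, where \<iota> is onto.\<close>

lemma dtau_right_translate:
  assumes "\<xi> \<in> W"
  shows "tangent_of_map A \<tau> \<xi> \<eta> = pushforward A (\<lambda>h. mul h (\<tau> \<xi>)) (\<iota> (dtau A mul \<iota> \<tau> \<xi> \<eta>))"
  unfolding dtau_def
proof (rule theI')
  let ?X = "tangent_of_map A \<tau> \<xi> \<eta>"
  have "pushforward A (\<lambda>h. mul h (\<tau> (- \<xi>))) ?X \<in> tangent_space A (mul (\<tau> \<xi>) (\<tau> (- \<xi>)))"
    by (rule pushforward_in_tangent_space[OF atlas tangent_of_map_in_tangent_space[OF assms]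
          smooth_functions_right_translate])
  then obtain \<zeta> where \<zeta>: "\<iota> \<zeta> = pushforward A (\<lambda>h. mul h (\<tau> (- \<xi>))) ?X"
    using iso by (auto simp: lie_algebra_iso_def bij_betw_def mul_\<tau>_minus) (metis imageE)
  have "?X f = pushforward A (\<lambda>h. mul h (\<tau> \<xi>)) (\<iota> \<zeta>) f" for f
    using smooth_functions_right_translate[of f "\<tau> \<xi>"]
    by (simp add: \<zeta> pushforward_def o_def G.assoc mul_\<tau>_minus tangent_of_map_def)
  \<comment> \<open>Testing on functions already translated by \<tau>(-\<xi>) undoes the translation
    and recovers \<open>\<iota> \<zeta>'\<close> itself.\<close>
  moreover have "\<zeta>' = \<zeta>" if "?X = pushforward A (\<lambda>h. mul h (\<tau> \<xi>)) (\<iota> \<zeta>')" for \<zeta>'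
  proof (rule \<iota>_eqI)
    fix f assume f: "f \<in> smooth_functions A"
    have "?X (f \<circ> (\<lambda>h. mul h (\<tau> (- \<xi>)))) = \<iota> \<zeta>' f"
      using smooth_functions_right_translate[OF f, of "\<tau> (- \<xi>)"]
      by (subst that) (simp add: pushforward_def o_def G.assoc mul_\<tau>_minus)
    then show "\<iota> \<zeta>' f = \<iota> \<zeta> f" using f by (simp add: \<zeta> pushforward_def)
  qed
  ultimately show "\<exists>!\<zeta>. ?X = pushforward A (\<lambda>h. mul h (\<tau> \<xi>)) (\<iota> \<zeta>)"
    by blast
qed

text \<open>This turns the implicit description of \<open>dtau\<close> into an ordinary derivative.
  Its linearity and its relation to \<open>Ad\<close> are read off from this formula, one test
  function at a time.\<close>

lemma \<iota>_dtau:
  assumes "\<xi> \<in> W" "f \<in> smooth_functions A"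
  shows "\<iota> (dtau A mul \<iota> \<tau> \<xi> \<eta>) f =
    frechet_derivative (f \<circ> (\<lambda>h. mul h (\<tau> (- \<xi>))) \<circ> \<tau>) (at \<xi>) \<eta>"
proof -
  let ?f = "f \<circ> (\<lambda>h. mul h (\<tau> (- \<xi>)))"
  have f: "?f \<in> smooth_functions A" by (rule smooth_functions_right_translate[OF assms(2)])
  then have "frechet_derivative (?f \<circ> \<tau>) (at \<xi>) \<eta> = \<iota> (dtau A mul \<iota> \<tau> \<xi> \<eta>) (?f \<circ> (\<lambda>h. mul h (\<tau> \<xi>)))"
    using fun_cong[OF dtau_right_translate[OF assms(1), of \<eta>], of ?f]
    by (simp add: tangent_of_map_def pushforward_def)
  also have "?f \<circ> (\<lambda>h. mul h (\<tau> \<xi>)) = f"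
    by (simp add: fun_eq_iff G.assoc mul_\<tau>_minus)
  finally show ?thesis by (rule sym)
qed

lemma linear_dtau:
  assumes "\<xi> \<in> W"
  shows "linear (dtau A mul \<iota> \<tau> \<xi>)"
proof -
  have l: "linear (frechet_derivative (f \<circ> (\<lambda>h. mul h (\<tau> (- \<xi>))) \<circ> \<tau>) (at \<xi>))"
    if "f \<in> smooth_functions A" for f
    by (rule linear_frechet_derivative[OF differentiable_comp_\<tau>[OF smooth_functions_right_translate[OF that] assms]])
  have add: "\<iota> (x + y) f = \<iota> x f + \<iota> y f" and scale: "\<iota> (c *\<^sub>R x) f = c * \<iota> x f" for x y c f
    using iso by (auto simp: lie_algebra_iso_def)
  show ?thesis
  proof (rule linearI)
    show "dtau A mul \<iota> \<tau> \<xi> (x + y) = dtau A mul \<iota> \<tau> \<xi> x + dtau A mul \<iota> \<tau> \<xi> y" for x y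
      by (rule \<iota>_eqI) (simp add: add \<iota>_dtau[OF assms] linear_add[OF l])
    show "dtau A mul \<iota> \<tau> \<xi> (c *\<^sub>R x) = c *\<^sub>R dtau A mul \<iota> \<tau> \<xi> x" for c x
      by (rule \<iota>_eqI) (simp add: scale \<iota>_dtau[OF assms] linear_scale[OF l])
  qed
qed

text \<open>Transport \<open>F\<close> by the inverse of \<tau> and extend by zero. The image of
  \<open>K\<close> is compact, hence closed in the Hausdorff group, so its complement is open and
  together with \<tau>(W) covers the group; the extension is smooth on both pieces.\<close>

lemma smooth_function_transfer:
  fixes F :: "'a \<Rightarrow> real"
  assumes F: "smooth_on UNIV F" and K: "compact K" "K \<subseteq> W" and supp: "\<And>x. x \<notin> K \<Longrightarrow> F x = 0"
  shows "\<exists>f\<in>smooth_functions A. \<forall>x\<in>W. f (\<tau> x) = F x"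
proof -
  obtain V where V: "analytic_diffeo flat_atlas A W V \<tau>"
    using retraction by (auto simp: lie_retraction_def)
  define \<sigma> where "\<sigma> = inv_into W \<tau>"
  have bij: "bij_betw \<tau> W V" and \<sigma>: "smooth_map A flat_atlas V \<sigma>"
    using V by (auto simp: analytic_diffeo_def \<sigma>_def intro: analytic_map_imp_smooth_map)
  have \<sigma>\<tau>: "\<sigma> (\<tau> x) = x" if "x \<in> W" for x
    using bij that by (auto simp: bij_betw_def \<sigma>_def inv_into_f_f)
  have oV: "open V" using \<sigma> by (simp add: regular_map_def)
  have cK: "closed (\<tau> ` K)"
    using K continuous_on_\<tau> by (meson compact_continuous_image compact_imp_closed continuous_on_subset)
  define f where "f p = (if p \<in> V then F (\<sigma> p) else 0)" for p
  have f\<tau>: "f (\<tau> x) = F x" if "x \<in> W" for x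
    using bij that by (auto simp: f_def \<sigma>\<tau> bij_betw_def)
  have f0: "f p = 0" if "p \<notin> \<tau> ` K" for p
  proof (cases "p \<in> V")
    case True
    then obtain x where "x \<in> W" "p = \<tau> x" using bij by (auto simp: bij_betw_def)
    then show ?thesis using that supp f\<tau> by auto
  qed (simp add: f_def)
  have "f \<in> smooth_functions A"
    unfolding smooth_functions_iff[OF atlas]
  proof (clarify, rule smooth_on_local)
    fix U \<phi> x assume U: "(U, \<phi>) \<in> A" and "x \<in> \<phi> ` U"
    then obtain p where p: "p \<in> U" "x = \<phi> p" by blast
    note cU = analytic_atlasD(1)[OF atlas U]
    note ch = is_chartD[OF cU]
    show "\<exists>T. open T \<and> x \<in> T \<and> smooth_on T (f \<circ> inv_into U \<phi>)"
    proof (cases "p \<in> V")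
      case True
      have o: "open (\<phi> ` (V \<inter> U))"
        by (rule is_chart_open_image[OF cU]) (use oV ch(1) in auto)
      have "smooth_on (\<phi> ` (V \<inter> U)) (\<sigma> \<circ> inv_into U \<phi>)"
        using \<sigma> U by (auto simp: regular_map_def flat_atlas_def)
      then have "smooth_on (\<phi> ` (V \<inter> U)) (F \<circ> (\<sigma> \<circ> inv_into U \<phi>))"
        by (rule smooth_on_compose[OF F]) simp
      then have "smooth_on (\<phi> ` (V \<inter> U)) (f \<circ> inv_into U \<phi>)"
        by (rule smooth_on_cong[OF _ o]) (use ch(3) in \<open>auto simp: f_def inv_into_f_f\<close>)
      then show ?thesis using o p True by blast
    next
      case False
      have o: "open (\<phi> ` (U - \<tau> ` K))"
        by (rule is_chart_open_image[OF cU]) (use cK ch(1) in auto)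
      have "smooth_on (\<phi> ` (U - \<tau> ` K)) (f \<circ> inv_into U \<phi>)"
        by (rule smooth_on_cong[OF smooth_on_const[of _ 0] o]) (use ch(3) in \<open>auto simp: f0 inv_into_f_f\<close>)
      moreover have "p \<notin> \<tau> ` K" using False K(2) bij by (auto simp: bij_betw_def)
      ultimately show ?thesis using o p by blast
    qed
  qed
  then show ?thesis using f\<tau> by blast
qed

text \<open>The test function is, through \<tau>, the linear functional dual to \<eta> centred at
  \<xi>, cut off by a bump supported in a ball inside \<open>W\<close>.\<close>

lemma tangent_of_map_nonzero:
  assumes \<xi>: "\<xi> \<in> W" and \<eta>: "\<eta> \<noteq> 0"
  shows "\<exists>f\<in>smooth_functions A. frechet_derivative (f \<circ> \<tau>) (at \<xi>) \<eta> \<noteq> 0"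
proof -
  obtain r where r: "r > 0" "cball \<xi> r \<subseteq> W"
    using open_W \<xi> open_contains_cball by blast
  define u where "u x = (x - \<xi>) \<bullet> \<eta>" for x
  \<comment> \<open>The argument of \<open>flat_exp 0\<close> is positive exactly inside the ball of
    radius \<open>r\<close>, so \<open>v\<close> vanishes outside and is positive at the
    centre.\<close>
  define v where "v x = flat_exp 0 (r\<^sup>2 - (x - \<xi>) \<bullet> (x - \<xi>))" for x
  have id: "smooth_on UNIV (\<lambda>x. x - \<xi>)"
    using smooth_on_add[OF smooth_on_id smooth_on_const[of _ "- \<xi>"]] by simp
  have su: "smooth_on UNIV u"
    unfolding u_def by (rule smooth_on_bounded_linear[OF bounded_linear_inner_left id])
  have "smooth_on UNIV (\<lambda>x. r\<^sup>2 + - ((x - \<xi>) \<bullet> (x - \<xi>)))"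
    by (intro smooth_on_add smooth_on_const smooth_on_bounded_linear[OF bounded_linear_minus[OF bounded_linear_ident]]
        smooth_on_bounded_bilinear[OF bounded_bilinear_inner] id)
  then have "smooth_on UNIV (flat_exp 0 \<circ> (\<lambda>x. r\<^sup>2 - (x - \<xi>) \<bullet> (x - \<xi>)))"
    by (intro smooth_on_compose[OF smooth_on_flat_exp[of UNIV]]) auto
  then have sv: "smooth_on UNIV v" by (simp add: v_def[abs_def] o_def)
  have "smooth_on UNIV (\<lambda>x. u x * v x)"
    by (rule smooth_on_bounded_bilinear[OF bounded_bilinear_mult su sv])
  moreover have "u x * v x = 0" if "x \<notin> cball \<xi> r" for x
  proof -
    have "r < norm (x - \<xi>)" using that by (simp add: dist_norm norm_minus_commute)
    then have "r\<^sup>2 < (norm (x - \<xi>))\<^sup>2" using r(1) by (intro power_strict_mono) auto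
    then show ?thesis by (simp add: v_def flat_exp_def power2_norm_eq_inner)
  qed
  ultimately obtain f where f: "f \<in> smooth_functions A" "\<And>x. x \<in> W \<Longrightarrow> f (\<tau> x) = u x * v x"
    using smooth_function_transfer[OF _ compact_cball r(2)] by blast
  have du: "(u has_derivative (\<lambda>h. h \<bullet> \<eta>)) (at \<xi>)"
    unfolding u_def by (auto intro!: derivative_eq_intros)
  obtain v' where dv: "(v has_derivative v') (at \<xi>)"
    using smooth_on_imp_differentiable[OF sv UNIV_I, of \<xi>] by (auto simp: differentiable_def)
  \<comment> \<open>Since \<open>u \<xi> = 0\<close>, the product rule loses the term containing
    \<open>v'\<close>.\<close>
  have "((\<lambda>x. u x * v x) has_derivative (\<lambda>h. (h \<bullet> \<eta>) * v \<xi>)) (at \<xi>)"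
    using has_derivative_mult[OF du dv] by (simp add: u_def)
  then have "(f \<circ> \<tau> has_derivative (\<lambda>h. (h \<bullet> \<eta>) * v \<xi>)) (at \<xi>)"
    by (rule has_derivative_transform_within_open[OF _ open_W \<xi>]) (simp add: f(2))
  then have "frechet_derivative (f \<circ> \<tau>) (at \<xi>) \<eta> = (\<eta> \<bullet> \<eta>) * v \<xi>"
    by (simp add: frechet_derivative_at[symmetric])
  also have "\<dots> \<noteq> 0" using \<eta> r(1) by (simp add: v_def flat_exp_def)
  finally show ?thesis using f(1) by blast
qed

lemma bij_dtau:
  assumes "\<xi> \<in> W"
  shows "bij (dtau A mul \<iota> \<tau> \<xi>)"
proof -
  have "\<eta> = 0" if "dtau A mul \<iota> \<tau> \<xi> \<eta> = 0" for \<eta>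
  proof (rule ccontr)
    assume "\<eta> \<noteq> 0"
    then obtain f where f: "f \<in> smooth_functions A" "frechet_derivative (f \<circ> \<tau>) (at \<xi>) \<eta> \<noteq> 0"
      using tangent_of_map_nonzero[OF assms] by blast
    \<comment> \<open>Homogeneity with scalar 0 gives that \<open>\<iota> 0\<close> is the zero
      derivation, contradicting the choice of \<open>f\<close>.\<close>
    have "\<iota> (0 *\<^sub>R 0) g = 0 * \<iota> 0 g" for g
      using iso unfolding lie_algebra_iso_def by blast
    then show False
      using fun_cong[OF dtau_right_translate[OF assms, of \<eta>], of f] f that
      by (simp add: tangent_of_map_def pushforward_def)
  qed
  then have "inj (dtau A mul \<iota> \<tau> \<xi>)"
    using linear_injective_0[OF linear_dtau[OF assms]] by blast
  then show ?thesis
    using linear_injective_imp_surjective[OF linear_dtau[OF assms]] by (simp add: bij_def)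
qed

lemma dtau_inv_dtau: "\<xi> \<in> W \<Longrightarrow> dtau_inv A mul \<iota> \<tau> \<xi> (dtau A mul \<iota> \<tau> \<xi> \<eta>) = \<eta>"
  and dtau_dtau_inv: "\<xi> \<in> W \<Longrightarrow> dtau A mul \<iota> \<tau> \<xi> (dtau_inv A mul \<iota> \<tau> \<xi> \<eta>) = \<eta>"
  using bij_dtau by (auto simp: dtau_inv_def bij_is_inj bij_is_surj surj_f_inv_f)

lemma linear_dtau_inv: "\<xi> \<in> W \<Longrightarrow> linear (dtau_inv A mul \<iota> \<tau> \<xi>)"
  unfolding dtau_inv_def using linear_dtau bij_dtau
  by (metis bij_is_inj bij_is_surj inj_linear_imp_inv_linear)

text \<open>Differentiate \<open>\<tau>(x) \<tau>(-x) = e\<close> at \<open>x = \<xi>\<close>.\<close>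

lemma Ad_dtau_minus:
  assumes \<xi>: "\<xi> \<in> W" "- \<xi> \<in> W"
  shows "Ad A mul invs \<iota> (\<tau> \<xi>) (dtau A mul \<iota> \<tau> (- \<xi>) \<eta>) = dtau A mul \<iota> \<tau> \<xi> \<eta>"
proof -
  let ?c = "\<lambda>h. mul (mul (\<tau> \<xi>) h) (invs (\<tau> \<xi>))"
  have smooth_c: "f \<circ> ?c \<in> smooth_functions A" if "f \<in> smooth_functions A" for f
    using smooth_functions_left_translate[OF smooth_functions_right_translate[OF that]]
    by (simp add: o_def)
  have "\<iota> (dtau A mul \<iota> \<tau> \<xi> \<eta>) f = \<iota> (dtau A mul \<iota> \<tau> (- \<xi>) \<eta>) (f \<circ> ?c)"
    if f: "f \<in> smooth_functions A" for f
  proof -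
    \<comment> \<open>Separating the two occurrences of \<open>x\<close> in \<tau>(x) \<tau>(-x)
      lets the two partial derivatives be identified individually. Joint differentiability at
      (\<xi>, -\<xi>) comes from the chart expression of the multiplication.\<close>
    define H where "H = (\<lambda>(x, y). f (mul (\<tau> x) (\<tau> y)))"
    obtain U \<phi> where U: "(U, \<phi>) \<in> A" "\<tau> \<xi> \<in> U" using analytic_atlasD(2)[OF atlas] by blast
    obtain V \<psi> where V: "(V, \<psi>) \<in> A" "\<tau> (- \<xi>) \<in> V" using analytic_atlasD(2)[OF atlas] by blast
    let ?S = "(W \<inter> \<tau> -` U) \<times> (W \<inter> \<tau> -` V)"
    have "smooth_on ?S ((\<phi> \<circ> \<tau>) \<circ> fst)" "smooth_on ?S ((\<psi> \<circ> \<tau>) \<circ> snd)"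
      by (rule smooth_on_compose[OF smooth_on_chart_\<tau>(2)[OF U(1)]]
          smooth_on_compose[OF smooth_on_chart_\<tau>(2)[OF V(1)]],
          use smooth_on_bounded_linear[OF bounded_linear_fst smooth_on_id]
            smooth_on_bounded_linear[OF bounded_linear_snd smooth_on_id] in auto)+
    then have "smooth_on ?S (\<lambda>z. (((\<phi> \<circ> \<tau>) \<circ> fst) z, ((\<psi> \<circ> \<tau>) \<circ> snd) z))"
      by (rule smooth_on_Pair)
    then have "smooth_on ?S ((\<lambda>(x, y). f (mul (inv_into U \<phi> x) (inv_into V \<psi> y))) \<circ>
        (\<lambda>z. (((\<phi> \<circ> \<tau>) \<circ> fst) z, ((\<psi> \<circ> \<tau>) \<circ> snd) z)))"
      by (rule smooth_on_compose[OF smooth_on_mul_charts[OF f U(1) V(1)]]) auto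
    then have "smooth_on ?S H"
      using is_chartD(3)[OF analytic_atlasD(1)[OF atlas U(1)]] is_chartD(3)[OF analytic_atlasD(1)[OF atlas V(1)]]
      by (elim smooth_on_cong)
        (auto simp: H_def inv_into_f_f intro!: open_Times smooth_on_chart_\<tau>(1) U(1) V(1))
    then obtain H' where H': "(H has_derivative H') (at (\<xi>, - \<xi>))"
      using smooth_on_imp_differentiable[of ?S H "(\<xi>, - \<xi>)"] \<xi> U(2) V(2)
      by (auto simp: differentiable_def)
    have "((\<lambda>x. H (x, - \<xi>)) has_derivative (\<lambda>h. H' (h, 0))) (at \<xi>)"
      by (rule has_derivative_compose[of "\<lambda>x. (x, - \<xi>)", OF _ H']) (auto intro!: derivative_eq_intros)
    then have D1: "\<iota> (dtau A mul \<iota> \<tau> \<xi> \<eta>) f = H' (\<eta>, 0)"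
      by (simp add: \<iota>_dtau[OF \<xi>(1) f] H_def o_def frechet_derivative_at[symmetric])
    have "((\<lambda>y. H (\<xi>, y)) has_derivative (\<lambda>h. H' (0, h))) (at (- \<xi>))"
      by (rule has_derivative_compose[of "\<lambda>y. (\<xi>, y)", OF _ H']) (auto intro!: derivative_eq_intros)
    \<comment> \<open>The factor \<tau>(\<xi>) from the trivialization at -\<xi> cancels against the
      inverse in the conjugation, leaving \<tau>(\<xi>) \<tau>(y).\<close>
    moreover have "f \<circ> ?c \<circ> (\<lambda>h. mul h (\<tau> (- (- \<xi>)))) \<circ> \<tau> = (\<lambda>y. H (\<xi>, y))"
      by (simp add: fun_eq_iff H_def G.assoc invs_\<tau> mul_\<tau>_minus)
    ultimately have D2: "\<iota> (dtau A mul \<iota> \<tau> (- \<xi>) \<eta>) (f \<circ> ?c) = H' (0, \<eta>)"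
      by (simp only: \<iota>_dtau[OF \<xi>(2) smooth_c[OF f]] frechet_derivative_at[symmetric])
    \<comment> \<open>Along the antidiagonal \<open>H\<close> is constantly \<open>f e\<close>, so
      its derivative there is zero and the two partial derivatives agree.\<close>
    have "((\<lambda>x. H (x, - x)) has_derivative (\<lambda>h. H' (h, - h))) (at \<xi>)"
      by (rule has_derivative_compose[of "\<lambda>x. (x, - x)", OF _ H']) (auto intro!: derivative_eq_intros)
    then have "((\<lambda>x. f e) has_derivative (\<lambda>h. H' (h, - h))) (at \<xi>)"
      by (simp add: H_def mul_\<tau>_minus)
    then have "H' (\<eta>, - \<eta>) = 0"
      using has_derivative_unique has_derivative_const by metis
    then have "H' ((\<eta>, 0) - (0, \<eta>)) = 0" by simp
    then show ?thesis
      using linear_diff[OF has_derivative_linear[OF H'], of "(\<eta>, 0)" "(0, \<eta>)"] D1 D2 by simp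
  qed
  then have "\<iota> (dtau A mul \<iota> \<tau> \<xi> \<eta>) = pushforward A ?c (\<iota> (dtau A mul \<iota> \<tau> (- \<xi>) \<eta>))"
    by (auto simp: pushforward_def \<iota>_not_smooth)
  then show ?thesis
    \<comment> \<open>The identity just proved supplies the element described by \<open>Ad\<close>;
      injectivity of \<iota> gives its uniqueness.\<close>
    unfolding Ad_def by (intro the_equality) (auto intro: \<iota>_eqI dest: fun_cong)
qed

text \<open>This eliminates \<open>Ad\<close> from the variations and is the source of the index
  -\<epsilon>\<xi> in the second term of the equations.\<close>

corollary dtau_inv_Ad:
  assumes "\<xi> \<in> W" "- \<xi> \<in> W"
  shows "dtau_inv A mul \<iota> \<tau> \<xi> (Ad A mul invs \<iota> (\<tau> \<xi>) \<eta>) = dtau_inv A mul \<iota> \<tau> (- \<xi>) \<eta>"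
  using Ad_dtau_minus[OF assms, of "dtau_inv A mul \<iota> \<tau> (- \<xi>) \<eta>"] dtau_inv_dtau[OF assms(1)]
    dtau_dtau_inv[OF assms(2)] by metis

end

section \<open>The discrete Euler-Poincare-Suslov equations\<close>

lemma annihilator_constraint_space:
  fixes a :: "nat \<Rightarrow> ('a::euclidean_space \<Rightarrow>\<^sub>L real)"
  assumes inj: "inj_on a {1..m}"
  shows "(\<forall>v\<in>constraint_space m a. blinfun_apply \<mu> v = 0) \<longleftrightarrow>
    (\<exists>c. \<mu> = (\<Sum>\<alpha> = 1..m. c \<alpha> *\<^sub>R a \<alpha>))"
proof
  assume \<mu>: "\<forall>v\<in>constraint_space m a. blinfun_apply \<mu> v = 0"
  \<comment> \<open>\<open>r\<close> is the Riesz representation of functionals by vectors. The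
    constraint space becomes the orthogonal complement of a span, and a double complement in finite
    dimension returns the span.\<close>
  define r :: "('a \<Rightarrow>\<^sub>L real) \<Rightarrow> 'a" where "r \<nu> = (\<Sum>b\<in>Basis. blinfun_apply \<nu> b *\<^sub>R b)" for \<nu>
  have r: "blinfun_apply \<nu> v = r \<nu> \<bullet> v" for \<nu> v
  proof -
    have "blinfun_apply \<nu> v = blinfun_apply \<nu> (\<Sum>b\<in>Basis. (v \<bullet> b) *\<^sub>R b)"
      by (simp add: euclidean_representation)
    also have "\<dots> = r \<nu> \<bullet> v"
      by (simp add: r_def blinfun.sum_right blinfun.scaleR_right inner_sum_left)
        (simp add: inner_commute mult.commute)
    finally show ?thesis .
  qed
  \<comment> \<open>Membership in the span yields coefficients indexed by vectors; injectivity
    converts them into coefficients indexed by \<open>\<alpha>\<close>.\<close>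
  have "inj_on (r \<circ> a) {1..m}"
    by (rule comp_inj_on[OF inj]) (metis r blinfun_eqI inj_onI)
  then have reindex: "(\<Sum>v\<in>(r \<circ> a) ` {1..m}. u v *\<^sub>R v) = (\<Sum>\<alpha> = 1..m. u (r (a \<alpha>)) *\<^sub>R r (a \<alpha>))" for u
    using sum.reindex[of "r \<circ> a" "{1..m}" "\<lambda>v. u v *\<^sub>R v"] by (simp add: o_def)
  let ?U = "span ((r \<circ> a) ` {1..m})"
  have "r \<mu> \<bullet> v = 0" if "v \<in> ?U\<^sup>\<bottom>" for v
  proof -
    have "r (a \<alpha>) \<bullet> v = 0" if "\<alpha> \<in> {1..m}" for \<alpha>
      using \<open>v \<in> ?U\<^sup>\<bottom>\<close> span_base[of "r (a \<alpha>)" "(r \<circ> a) ` {1..m}"] that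
      by (auto simp: orthogonal_comp_def orthogonal_def)
    then show ?thesis using \<mu> r by (simp add: constraint_space_def)
  qed
  then have "r \<mu> \<in> ?U\<^sup>\<bottom>\<^sup>\<bottom>"
    unfolding orthogonal_comp_def[of "?U\<^sup>\<bottom>"] by (simp only: mem_Collect_eq orthogonal_def inner_commute) blast
  then have "r \<mu> \<in> ?U" by (simp add: orthogonal_comp_self)
  then obtain u where u: "r \<mu> = (\<Sum>\<alpha> = 1..m. u (r (a \<alpha>)) *\<^sub>R r (a \<alpha>))"
    unfolding span_finite[OF finite_imageI[OF finite_atLeastAtMost]] reindex by blast
  have "\<mu> = (\<Sum>\<alpha> = 1..m. u (r (a \<alpha>)) *\<^sub>R a \<alpha>)"
    by (rule blinfun_eqI, subst r)
      (simp add: u inner_sum_left blinfun.sum_left blinfun.scaleR_left r[symmetric])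
  then show "\<exists>c. \<mu> = (\<Sum>\<alpha> = 1..m. c \<alpha> *\<^sub>R a \<alpha>)" by (rule exI[of _ "\<lambda>\<alpha>. u (r (a \<alpha>))"])
next
  assume "\<exists>c. \<mu> = (\<Sum>\<alpha> = 1..m. c \<alpha> *\<^sub>R a \<alpha>)"
  then show "\<forall>v\<in>constraint_space m a. blinfun_apply \<mu> v = 0"
    by (auto simp: constraint_space_def blinfun.sum_left blinfun.scaleR_left)
qed

text \<open>\<open>Blinfun\<close> can be evaluated once its argument is bounded linear, which
  linearity gives in finite dimension.\<close>

lemma dual_map_apply:
  assumes "linear T"
  shows "blinfun_apply (dual_map T \<mu>) v = blinfun_apply \<mu> (T v)"
proof -
  have "bounded_linear (\<lambda>v. blinfun_apply \<mu> (T v))"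
    by (rule bounded_linear_compose[OF blinfun.bounded_linear_right linear_conv_bounded_linear[THEN iffD1, OF assms]])
  then show ?thesis by (simp add: dual_map_def bounded_linear_Blinfun_apply)
qed

text \<open>Variations concentrated at one interior index isolate the functionals
  \<open>\<mu> k\<close> one by one; \<open>D\<close> contains 0 so that such variations are
  admissible.\<close>

lemma (in lie_group_retraction) critical_point_iff:
  fixes l :: "'a \<Rightarrow> real"
  assumes D: "0 \<in> D" and \<epsilon>: "\<epsilon> > 0" and N: "N \<ge> 2"
    and W: "\<forall>k\<in>{0..N - 1}. \<epsilon> *\<^sub>R \<xi> k \<in> W \<and> - (\<epsilon> *\<^sub>R \<xi> k) \<in> W"
  defines "\<mu> \<equiv> \<lambda>k. dual_map (dtau_inv A mul \<iota> \<tau> (\<epsilon> *\<^sub>R \<xi> (k + 1))) (differential l (\<xi> (k + 1)))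
     - dual_map (dtau_inv A mul \<iota> \<tau> (- (\<epsilon> *\<^sub>R \<xi> k))) (differential l (\<xi> k))"
  shows "critical_point A mul invs \<iota> \<tau> \<epsilon> N l D \<xi> \<longleftrightarrow>
    (\<forall>k\<in>{0..N - 2}. \<forall>v\<in>D. blinfun_apply (\<mu> k) v = 0)"
proof -
  \<comment> \<open>Writing \<open>N\<close> as \<open>M + 2\<close> removes truncated subtraction:
    the last \<xi> has index \<open>Suc M\<close>, the last equation index \<open>M\<close>.\<close>
  obtain M where M: "N = Suc (Suc M)"
    using N by (metis add_2_eq_Suc le_Suc_ex)
  \<comment> \<open>Up to sign and the factor 1/\<epsilon>, \<open>B k\<close> is the coefficient of
    \<open>\<eta> k\<close> in the k-th term of the action variation, and \<open>C k\<close> that of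
    \<open>\<eta> (k + 1)\<close>.\<close>
  define B where "B k v = blinfun_apply (differential l (\<xi> k)) (dtau_inv A mul \<iota> \<tau> (\<epsilon> *\<^sub>R \<xi> k) v)" for k v
  define C where "C k v = blinfun_apply (differential l (\<xi> k)) (dtau_inv A mul \<iota> \<tau> (- (\<epsilon> *\<^sub>R \<xi> k)) v)" for k v
  have W': "\<epsilon> *\<^sub>R \<xi> k \<in> W" "- (\<epsilon> *\<^sub>R \<xi> k) \<in> W" if "k \<le> Suc M" for k
    using W that by (auto simp: M)
  have \<mu>: "blinfun_apply (\<mu> k) v = B (Suc k) v - C k v" if "k \<le> M" for k v
    using that W' by (simp add: \<mu>_def B_def C_def dual_map_apply linear_dtau_inv blinfun.diff_left)
  have zero: "B k 0 = 0" "C k 0 = 0" if "k \<le> Suc M" for k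
    using W'[OF that] by (simp_all add: B_def C_def linear_0[OF linear_dtau_inv] blinfun.zero_right)
  have action: "(\<Sum>k = 0..N - 1. blinfun_apply (differential l (\<xi> k)) (delta_xi A mul invs \<iota> \<tau> \<epsilon> \<xi> \<eta> k))
      = - (1 / \<epsilon>) * (\<Sum>k\<le>M. blinfun_apply (\<mu> k) (\<eta> (Suc k)))"
    if \<eta>: "\<eta> 0 = 0" "\<eta> N = 0" for \<eta>
  proof -
    have "blinfun_apply (differential l (\<xi> k)) (delta_xi A mul invs \<iota> \<tau> \<epsilon> \<xi> \<eta> k)
        = (1 / \<epsilon>) * (C k (\<eta> (Suc k)) - B k (\<eta> k))" if "k \<le> Suc M" for k
      using W'[OF that] linear_dtau_inv[of "\<epsilon> *\<^sub>R \<xi> k"]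
      by (simp add: delta_xi_def B_def C_def linear_diff dtau_inv_Ad
          blinfun.scaleR_right blinfun.diff_right diff_divide_distrib)
    then have "(\<Sum>k = 0..N - 1. blinfun_apply (differential l (\<xi> k)) (delta_xi A mul invs \<iota> \<tau> \<epsilon> \<xi> \<eta> k))
        = (\<Sum>k\<le>Suc M. (1 / \<epsilon>) * (C k (\<eta> (Suc k)) - B k (\<eta> k)))"
      by (intro sum.cong) (auto simp: M)
    also have "\<dots> = (1 / \<epsilon>) * ((\<Sum>k\<le>Suc M. C k (\<eta> (Suc k))) - (\<Sum>k\<le>Suc M. B k (\<eta> k)))"
      by (simp only: sum_distrib_left[symmetric] sum_subtractf)
    \<comment> \<open>The two endpoint conditions act here: the top term of the \<open>C\<close> sum
      contains \<open>\<eta> N\<close>, the bottom term of the \<open>B\<close> sum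
      \<open>\<eta> 0\<close>. After a shift both sums run over the interior variations.\<close>
    also have "(\<Sum>k\<le>Suc M. C k (\<eta> (Suc k))) = (\<Sum>k\<le>M. C k (\<eta> (Suc k)))"
      using \<eta>(2) by (simp add: M zero)
    also have "(\<Sum>k\<le>Suc M. B k (\<eta> k)) = (\<Sum>k\<le>M. B (Suc k) (\<eta> (Suc k)))"
      by (simp only: sum.atMost_Suc_shift) (simp add: \<eta>(1) zero)
    also have "(1 / \<epsilon>) * ((\<Sum>k\<le>M. C k (\<eta> (Suc k))) - (\<Sum>k\<le>M. B (Suc k) (\<eta> (Suc k))))
        = - (1 / \<epsilon>) * (\<Sum>k\<le>M. blinfun_apply (\<mu> k) (\<eta> (Suc k)))"
      by (simp add: \<mu> sum_subtractf algebra_simps)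
    finally show ?thesis .
  qed
  show ?thesis
  proof
    assume crit: "critical_point A mul invs \<iota> \<tau> \<epsilon> N l D \<xi>"
    show "\<forall>k\<in>{0..N - 2}. \<forall>v\<in>D. blinfun_apply (\<mu> k) v = 0"
    proof (intro ballI)
      fix k v assume k: "k \<in> {0..N - 2}" and v: "v \<in> D"
      \<comment> \<open>The shift to \<open>Suc k\<close> matches the pairing of
        \<open>\<mu> k\<close> with \<open>\<eta> (Suc k)\<close>. Since
        \<open>k \<le> N - 2\<close>, this index is neither 0 nor \<open>N\<close>.\<close>
      define \<eta> where "\<eta> j = (if j = Suc k then v else 0)" for j
      have \<eta>: "\<eta> 0 = 0" "\<eta> N = 0" using k by (auto simp: \<eta>_def M)
      have "(\<Sum>j\<le>M. blinfun_apply (\<mu> j) (\<eta> (Suc j))) = 0"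
        using crit action[OF \<eta>] \<eta> D v \<epsilon> unfolding critical_point_def by (auto simp: \<eta>_def)
      moreover have "(\<Sum>j\<le>M. blinfun_apply (\<mu> j) (\<eta> (Suc j))) = (\<Sum>j\<le>M. if j = k then blinfun_apply (\<mu> j) v else 0)"
        by (intro sum.cong) (auto simp: \<eta>_def blinfun.zero_right)
      ultimately show "blinfun_apply (\<mu> k) v = 0" using k by (simp add: M)
    qed
  next
    assume "\<forall>k\<in>{0..N - 2}. \<forall>v\<in>D. blinfun_apply (\<mu> k) v = 0"
    then show "critical_point A mul invs \<iota> \<tau> \<epsilon> N l D \<xi>"
      unfolding critical_point_def using action by (auto simp: M intro!: sum.neutral)
  qed
qed

theorem corollary4p4:
  fixes A :: "('g::{t2_space,second_countable_topology}, 'm::euclidean_space) chart set"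
    and mul :: "'g \<Rightarrow> 'g \<Rightarrow> 'g" and e :: 'g and invs :: "'g \<Rightarrow> 'g"
    and \<iota> :: "'a::euclidean_space \<Rightarrow> (('g \<Rightarrow> real) \<Rightarrow> real)"
    and m N :: nat and a :: "nat \<Rightarrow> ('a \<Rightarrow>\<^sub>L real)"
    and \<epsilon> :: real and \<tau> :: "'a \<Rightarrow> 'g" and W :: "'a set"
    and l :: "'a \<Rightarrow> real" and \<phi> :: "nat \<Rightarrow> 'g \<Rightarrow> real" and S :: "'g set"
    and \<xi> :: "nat \<Rightarrow> 'a"
  assumes "lie_group A mul e invs"
    and "lie_algebra_iso A e \<iota>"
    and "inj_on a {1..m}" and "independent (a ` {1..m})"
    and "\<epsilon> > 0" and "N \<ge> 2"
    and "lie_retraction A mul e W \<tau>"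
    and "smooth_on UNIV l"
    and "displacement_subvariety A e m \<phi> S"
    and "\<And>k. k \<in> {0..N - 1} \<Longrightarrow> \<epsilon> *\<^sub>R \<xi> k \<in> W \<and> - (\<epsilon> *\<^sub>R \<xi> k) \<in> W"
    and "\<And>\<alpha>. \<alpha> \<in> {1..m} \<Longrightarrow> (\<phi> \<alpha> \<circ> \<tau>) (\<xi> 0) = 0"
  shows
    "((\<forall>\<alpha>\<in>{1..m}. \<forall>k\<in>{0..N - 1}. (\<phi> \<alpha> \<circ> \<tau>) (\<xi> k) = 0) \<and>
      critical_point A mul invs \<iota> \<tau> \<epsilon> N l (constraint_space m a) \<xi>)
     \<longleftrightarrow>
     (\<forall>k\<in>{0..N - 2}.
        (\<exists>c :: nat \<Rightarrow> real.
           dual_map (dtau_inv A mul \<iota> \<tau> (\<epsilon> *\<^sub>R \<xi> (k + 1))) (differential l (\<xi> (k + 1)))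
           - dual_map (dtau_inv A mul \<iota> \<tau> (- (\<epsilon> *\<^sub>R \<xi> k))) (differential l (\<xi> k))
           = (\<Sum>\<alpha> = 1..m. c \<alpha> *\<^sub>R a \<alpha>)) \<and>
        (\<forall>\<alpha>\<in>{1..m}. (\<phi> \<alpha> \<circ> \<tau>) (\<xi> (k + 1)) = 0))"
proof -
  interpret lie_group_retraction A mul e invs \<iota> \<tau> W
    using assms(1,2,7) by unfold_locales
  have zero: "0 \<in> constraint_space m a" by (simp add: constraint_space_def blinfun.zero_right)
  have "\<forall>k\<in>{0..N - 1}. \<epsilon> *\<^sub>R \<xi> k \<in> W \<and> - (\<epsilon> *\<^sub>R \<xi> k) \<in> W"
    using assms(10) by blast
  note crit = critical_point_iff[OF zero assms(5,6) this, where l = l, unfolded annihilator_constraint_space[OF assms(3)]]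
  have "(\<forall>k\<in>{0..N - 1}. (\<phi> \<alpha> \<circ> \<tau>) (\<xi> k) = 0) \<longleftrightarrow> (\<forall>k\<in>{0..N - 2}. (\<phi> \<alpha> \<circ> \<tau>) (\<xi> (k + 1)) = 0)"
    if "\<alpha> \<in> {1..m}" for \<alpha>
  proof -
    \<comment> \<open>The equations constrain only the shifted indices; the remaining index 0 is
      covered by the assumption on \<open>\<xi> 0\<close>.\<close>
    have "{0..N - 1} = insert 0 ((\<lambda>k. k + 1) ` {0..N - 2})"
      using assms(6) by (auto simp: image_iff intro!: bexI[of _ "_ - 1"])
    then show ?thesis using assms(11)[OF that] by (simp only: ball_simps simp_thms)
  qed
  then show ?thesis unfolding crit by blast
qed

end
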